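(* Let $R$ be a commutative unital ring, let $S$ be an inverse semigroup, and let $\theta=(\{X_s\}_{s\in S},\{\theta_s\}_{s\in S})$ be a topological partial action of $S$ on a locally compact Hausdorff zero-dimensional topological space $X$. Let $\alpha=(\{D_s\}_{s\in S},\{\alpha_s\}_{s\in S})$ be the dual partial action of $\theta$ on $A_R(X)$. Then the Steinberg algebra $A_R(S\ltimes_\theta X)$ is isomorphic to the crossed product $A_R(X)\rtimes_\alpha S$.
   Context: An inverse semigroup $S$ is a semigroup in which every $s$ has a unique $s^*$ with $ss^*s=s$, $s^*ss^*=s^*$; $E(S)$ is its set of idempotents, and $s\le t$ means $s=ts^*s$. For a set $X$, $\mathcal{I}(X)$ is the inverse semigroup of partial bijections of $X$ under composition of partial maps. A partial homomorphism $\varphi:S\to T$ of inverse semigroups satisfies $\varphi(s^* )=\varphi(s)^*$, $\varphi(s)\varphi(t)\le\varphi(st)$, and $\varphi(s)\le\varphi(t)$ whenever $s\le t$. A topological partial action $\theta=(\{X_s\},\{\theta_s\})$ of $S$ on a space $X$ consists of open sets $X_s\subseteq X$ and homeomorphisms $\theta_s:X_{s^*}\to X_s$ such that $s\mapsto\theta_s$ is a partial homomorphism $S\to\mathcal{I}(X)$ and $X=\bigcup_{e\in E(S)}X_e$. Groupoid of germs: let $S*X=\{(s,x)\in S\times X: x\in X_{s^*}\}$; declare $(s,x)\sim(t,y)$ iff $x=y$ and there is $u\in S$ with $u\le s$, $u\le t$, $x\in X_{u^*}$. The germ $[s,x]$ is the class of $(s,x)$. $S\ltimes_\theta X$ is the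 set of germs, with source $x$, range $\theta_s(x)$, product $[s,x][t,y]=[st,y]$ when $x=\theta_t(y)$, inverse $[s^*,\theta_s(x)]$, unit space identified with $X$, and topology with basis the sets $[s,U]=\{[s,x]:x\in U\}$ for $s\in S$ and $U\subseteq X_{s^*}$ open. Steinberg algebras: for an ample groupoid $\mathcal{G}$ (an étale groupoid whose unit space is locally compact Hausdorff with a basis of compact-open sets), $A_R(\mathcal{G})$ is the $R$-span, inside the $R$-valued functions on $\mathcal{G}$, of characteristic functions of compact-open bisections, with convolution $(f*g)(a)=\sum_{bc=a}f(b)g(c)$. For $X$ locally compact Hausdorff zero-dimensional, $A_R(X)$ is the algebra of locally constant compactly supported functions $X\to R$ with pointwise operations. Dual partial action: $D_s=\{f\in A_R(X):\operatorname{supp}f\subseteq X_s\}$ and $\alpha_s:D_{s^*}\to D_s$, $\alpha_s(f)=f\circ\theta_{s^*}$ on $X_s$, extended by $0$ outside $X_s$. Crossed product: for an algebraic partial action $\alpha=(\{A_s\},\{\alpha_s\})$ of $S$ on an $R$-algebra $A$ (ideals $A_s$, $R$-isomorphisms $\alpha_s:A_{s^*}\to A_s$, $s\mapsto\alpha_s$ a partial homomorphism into $\mathcal{I}(A)$, and $A=\operatorname{span}_R\bigcup_{e\in E(S)}A_e$), let $\mathscr{L}$ be the $R$-module of finite formal sums $\sum a_s\delta_s$ with $a_s\in A_s$, with product $(a_s\delta_s)(b_t\delta_t)=\alpha_s(\alpha_{s^*}(a_s)b_t)\delta_{st}$, and let $\mathscr{N}$ be the additive subgroup generated by $a\delta_r-a\delta_s$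 with $r\le s$, $a\in A_r$. Then $A\rtimes_\alpha S=\mathscr{L}/\mathscr{N}$. *)

theory Defs
  imports "HOL-Analysis.Analysis"
begin

definition inverse_semigroup :: "('s \<Rightarrow> 's \<Rightarrow> 's) \<Rightarrow> bool" where
  "inverse_semigroup mul \<longleftrightarrow>
     (\<forall>a b c. mul (mul a b) c = mul a (mul b c)) \<and>
     (\<forall>s. \<exists>!t. mul (mul s t) s = s \<and> mul (mul t s) t = t)"

definition istar :: "('s \<Rightarrow> 's \<Rightarrow> 's) \<Rightarrow> 's \<Rightarrow> 's" where
  "istar mul s = (THE t. mul (mul s t) s = s \<and> mul (mul t s) t = t)"

definition idem :: "('s \<Rightarrow> 's \<Rightarrow> 's) \<Rightarrow> 's \<Rightarrow> bool" where
  "idem mul e \<longleftrightarrow> mul e e = e"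

definition ile :: "('s \<Rightarrow> 's \<Rightarrow> 's) \<Rightarrow> 's \<Rightarrow> 's \<Rightarrow> bool" where
  "ile mul s t \<longleftrightarrow> s = mul t (mul (istar mul s) s)"

text \<open>theta_s is the partial bijection with domain Xs (s*) and map th s.
The partial homomorphism conditions into I(X) are spelled out:
theta_{s*} = theta_s^{-1}; theta_s theta_t \<le> theta_{st} (restriction);
s \<le> t implies theta_s \<le> theta_t (restriction).\<close>

definition top_partial_action ::
  "('s \<Rightarrow> 's \<Rightarrow> 's) \<Rightarrow> 'x topology \<Rightarrow> ('s \<Rightarrow> 'x set) \<Rightarrow> ('s \<Rightarrow> 'x \<Rightarrow> 'x) \<Rightarrow> bool" where
  "top_partial_action mul X Xs th \<longleftrightarrow>
     (\<forall>s. openin X (Xs s)) \<and>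
     (\<forall>s. homeomorphic_map (subtopology X (Xs (istar mul s))) (subtopology X (Xs s)) (th s)) \<and>
     (\<forall>s. \<forall>x\<in>Xs (istar mul s). th (istar mul s) (th s x) = x) \<and>
     (\<forall>s t x. x \<in> Xs (istar mul t) \<and> th t x \<in> Xs (istar mul s) \<longrightarrow>
          x \<in> Xs (istar mul (mul s t)) \<and> th (mul s t) x = th s (th t x)) \<and>
     (\<forall>s t. ile mul s t \<longrightarrow>
          Xs (istar mul s) \<subseteq> Xs (istar mul t) \<and> (\<forall>x\<in>Xs (istar mul s). th s x = th t x)) \<and>
     topspace X = (\<Union>e\<in>{e. idem mul e}. Xs e)"

definition germ :: "('s \<Rightarrow> 's \<Rightarrow> 's) \<Rightarrow> ('s \<Rightarrow> 'x set) \<Rightarrow> 's \<Rightarrow> 'x \<Rightarrow> ('s \<times> 'x) set" where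
  "germ mul Xs s x = {(t, y). y = x \<and> x \<in> Xs (istar mul t) \<and>
       (\<exists>u. ile mul u s \<and> ile mul u t \<and> x \<in> Xs (istar mul u))}"

definition germs :: "('s \<Rightarrow> 's \<Rightarrow> 's) \<Rightarrow> ('s \<Rightarrow> 'x set) \<Rightarrow> ('s \<times> 'x) set set" where
  "germs mul Xs = {germ mul Xs s x | s x. x \<in> Xs (istar mul s)}"

definition gsrc :: "('s \<times> 'x) set \<Rightarrow> 'x" where
  "gsrc g = snd (SOME p. p \<in> g)"

definition grng :: "('s \<Rightarrow> 'x \<Rightarrow> 'x) \<Rightarrow> ('s \<times> 'x) set \<Rightarrow> 'x" where
  "grng th g = (case (SOME p. p \<in> g) of (s, x) \<Rightarrow> th s x)"

definition gmul :: "('s \<Rightarrow> 's \<Rightarrow> 's) \<Rightarrow> ('s \<Rightarrow> 'x set) \<Rightarrow> ('s \<times> 'x) set \<Rightarrow> ('s \<times> 'x) set \<Rightarrow> ('s \<times> 'x) set" where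
  "gmul mul Xs a b = (case (SOME p. p \<in> a, SOME q. q \<in> b) of
      ((s, x), (t, y)) \<Rightarrow> germ mul Xs (mul s t) y)"

definition germ_top :: "('s \<Rightarrow> 's \<Rightarrow> 's) \<Rightarrow> 'x topology \<Rightarrow> ('s \<Rightarrow> 'x set) \<Rightarrow> ('s \<times> 'x) set topology" where
  "germ_top mul X Xs = topology_generated_by
     {{germ mul Xs s x | x. x \<in> U} | s U. openin X U \<and> U \<subseteq> Xs (istar mul s)}"

definition compact_open_bisection ::
  "('s \<Rightarrow> 's \<Rightarrow> 's) \<Rightarrow> 'x topology \<Rightarrow> ('s \<Rightarrow> 'x set) \<Rightarrow> ('s \<Rightarrow> 'x \<Rightarrow> 'x) \<Rightarrow> ('s \<times> 'x) set set \<Rightarrow> bool" where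
  "compact_open_bisection mul X Xs th B \<longleftrightarrow>
     B \<subseteq> germs mul Xs \<and> openin (germ_top mul X Xs) B \<and> compactin (germ_top mul X Xs) B \<and>
     inj_on gsrc B \<and> inj_on (grng th) B"

inductive_set steinberg ::
  "('s \<Rightarrow> 's \<Rightarrow> 's) \<Rightarrow> 'x topology \<Rightarrow> ('s \<Rightarrow> 'x set) \<Rightarrow> ('s \<Rightarrow> 'x \<Rightarrow> 'x)
     \<Rightarrow> (('s \<times> 'x) set \<Rightarrow> 'r::comm_ring_1) set"
  for mul X Xs th where
  zero: "(\<lambda>_. 0) \<in> steinberg mul X Xs th"
| gen: "compact_open_bisection mul X Xs th B \<Longrightarrow>
          (\<lambda>g. if g \<in> B then c else 0) \<in> steinberg mul X Xs th"
| add: "f \<in> steinberg mul X Xs th \<Longrightarrow> h \<in> steinberg mul X Xs th \<Longrightarrow>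
          (\<lambda>g. f g + h g) \<in> steinberg mul X Xs th"

definition conv ::
  "('s \<Rightarrow> 's \<Rightarrow> 's) \<Rightarrow> ('s \<Rightarrow> 'x set) \<Rightarrow> ('s \<Rightarrow> 'x \<Rightarrow> 'x)
     \<Rightarrow> (('s \<times> 'x) set \<Rightarrow> 'r::comm_ring_1) \<Rightarrow> (('s \<times> 'x) set \<Rightarrow> 'r) \<Rightarrow> ('s \<times> 'x) set \<Rightarrow> 'r" where
  "conv mul Xs th f h a =
     (\<Sum>(b, c) \<in> {(b, c). b \<in> germs mul Xs \<and> c \<in> germs mul Xs \<and> gsrc b = grng th c \<and>
                   gmul mul Xs b c = a \<and> f b * h c \<noteq> 0}. f b * h c)"

definition AR_space :: "'x topology \<Rightarrow> ('x \<Rightarrow> 'r::comm_ring_1) set" where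
  "AR_space X = {f. (\<forall>x. x \<notin> topspace X \<longrightarrow> f x = 0) \<and>
      (\<forall>x\<in>topspace X. \<exists>U. openin X U \<and> x \<in> U \<and> (\<forall>y\<in>U. f y = f x)) \<and>
      (\<exists>K. compactin X K \<and> {x. f x \<noteq> 0} \<subseteq> K)}"

definition dualD :: "'x topology \<Rightarrow> ('s \<Rightarrow> 'x set) \<Rightarrow> 's \<Rightarrow> ('x \<Rightarrow> 'r::comm_ring_1) set" where
  "dualD X Xs s = {f \<in> AR_space X. {x. f x \<noteq> 0} \<subseteq> Xs s}"

definition dual_alpha :: "('s \<Rightarrow> 's \<Rightarrow> 's) \<Rightarrow> ('s \<Rightarrow> 'x set) \<Rightarrow> ('s \<Rightarrow> 'x \<Rightarrow> 'x)
    \<Rightarrow> 's \<Rightarrow> ('x \<Rightarrow> 'r::comm_ring_1) \<Rightarrow> 'x \<Rightarrow> 'r" where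
  "dual_alpha mul Xs th s f = (\<lambda>x. if x \<in> Xs s then f (th (istar mul s) x) else 0)"

text \<open>Elements of L: finitely supported families (a_s)_s with a_s \<in> A_s,
standing for the formal sum \<Sum> a_s \<delta>_s.  Here A_s, alpha_s are given generically.\<close>

definition cpL :: "('s \<Rightarrow> ('x \<Rightarrow> 'r::comm_ring_1) set) \<Rightarrow> ('s \<Rightarrow> 'x \<Rightarrow> 'r) set" where
  "cpL A = {\<xi>. finite {s. \<xi> s \<noteq> (\<lambda>_. 0)} \<and> (\<forall>s. \<xi> s \<in> A s)}"

definition cpL_add :: "('s \<Rightarrow> 'x \<Rightarrow> 'r::comm_ring_1) \<Rightarrow> ('s \<Rightarrow> 'x \<Rightarrow> 'r) \<Rightarrow> 's \<Rightarrow> 'x \<Rightarrow> 'r" where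
  "cpL_add \<xi> \<eta> = (\<lambda>s x. \<xi> s x + \<eta> s x)"

definition cpL_smul :: "'r::comm_ring_1 \<Rightarrow> ('s \<Rightarrow> 'x \<Rightarrow> 'r) \<Rightarrow> 's \<Rightarrow> 'x \<Rightarrow> 'r" where
  "cpL_smul c \<xi> = (\<lambda>s x. c * \<xi> s x)"

text \<open>(a_s \<delta>_s)(b_t \<delta>_t) = alpha_s(alpha_{s*}(a_s) b_t) \<delta>_{st}, extended bilinearly\<close>
definition cpL_mul :: "('s \<Rightarrow> 's \<Rightarrow> 's) \<Rightarrow> ('s \<Rightarrow> ('x \<Rightarrow> 'r) \<Rightarrow> 'x \<Rightarrow> 'r::comm_ring_1)
    \<Rightarrow> ('s \<Rightarrow> 'x \<Rightarrow> 'r) \<Rightarrow> ('s \<Rightarrow> 'x \<Rightarrow> 'r) \<Rightarrow> 's \<Rightarrow> 'x \<Rightarrow> 'r" where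
  "cpL_mul mul alpha \<xi> \<eta> = (\<lambda>u x.
     \<Sum>(s, t) \<in> {(s, t). \<xi> s \<noteq> (\<lambda>_. 0) \<and> \<eta> t \<noteq> (\<lambda>_. 0) \<and> mul s t = u}.
        alpha s (\<lambda>y. alpha (istar mul s) (\<xi> s) y * \<eta> t y) x)"

inductive_set cpN :: "('s \<Rightarrow> 's \<Rightarrow> 's) \<Rightarrow> ('s \<Rightarrow> ('x \<Rightarrow> 'r::comm_ring_1) set) \<Rightarrow> ('s \<Rightarrow> 'x \<Rightarrow> 'r) set"
  for mul A where
  zero: "(\<lambda>_ _. 0) \<in> cpN mul A"
| gen: "ile mul r s \<Longrightarrow> a \<in> A r \<Longrightarrow>
          (\<lambda>t x. (if t = r then a x else 0) - (if t = s then a x else 0)) \<in> cpN mul A"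
| diff: "\<xi> \<in> cpN mul A \<Longrightarrow> \<eta> \<in> cpN mul A \<Longrightarrow> (\<lambda>t x. \<xi> t x - \<eta> t x) \<in> cpN mul A"

definition cp_class :: "('s \<Rightarrow> 's \<Rightarrow> 's) \<Rightarrow> ('s \<Rightarrow> ('x \<Rightarrow> 'r::comm_ring_1) set)
    \<Rightarrow> ('s \<Rightarrow> 'x \<Rightarrow> 'r) \<Rightarrow> ('s \<Rightarrow> 'x \<Rightarrow> 'r) set" where
  "cp_class mul A \<xi> = {\<eta> \<in> cpL A. (\<lambda>t x. \<eta> t x - \<xi> t x) \<in> cpN mul A}"

definition crossed_product :: "('s \<Rightarrow> 's \<Rightarrow> 's) \<Rightarrow> ('s \<Rightarrow> ('x \<Rightarrow> 'r::comm_ring_1) set)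
    \<Rightarrow> ('s \<Rightarrow> 'x \<Rightarrow> 'r) set set" where
  "crossed_product mul A = cp_class mul A ` cpL A"

definition cp_add :: "('s \<Rightarrow> 's \<Rightarrow> 's) \<Rightarrow> ('s \<Rightarrow> ('x \<Rightarrow> 'r::comm_ring_1) set)
    \<Rightarrow> ('s \<Rightarrow> 'x \<Rightarrow> 'r) set \<Rightarrow> ('s \<Rightarrow> 'x \<Rightarrow> 'r) set \<Rightarrow> ('s \<Rightarrow> 'x \<Rightarrow> 'r) set" where
  "cp_add mul A P Q = cp_class mul A (cpL_add (SOME \<xi>. \<xi> \<in> P) (SOME \<eta>. \<eta> \<in> Q))"

definition cp_smul :: "('s \<Rightarrow> 's \<Rightarrow> 's) \<Rightarrow> ('s \<Rightarrow> ('x \<Rightarrow> 'r::comm_ring_1) set)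
    \<Rightarrow> 'r \<Rightarrow> ('s \<Rightarrow> 'x \<Rightarrow> 'r) set \<Rightarrow> ('s \<Rightarrow> 'x \<Rightarrow> 'r) set" where
  "cp_smul mul A c P = cp_class mul A (cpL_smul c (SOME \<xi>. \<xi> \<in> P))"

definition cp_mul :: "('s \<Rightarrow> 's \<Rightarrow> 's) \<Rightarrow> ('s \<Rightarrow> ('x \<Rightarrow> 'r::comm_ring_1) set)
    \<Rightarrow> ('s \<Rightarrow> ('x \<Rightarrow> 'r) \<Rightarrow> 'x \<Rightarrow> 'r)
    \<Rightarrow> ('s \<Rightarrow> 'x \<Rightarrow> 'r) set \<Rightarrow> ('s \<Rightarrow> 'x \<Rightarrow> 'r) set \<Rightarrow> ('s \<Rightarrow> 'x \<Rightarrow> 'r) set" where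
  "cp_mul mul A alpha P Q = cp_class mul A (cpL_mul mul alpha (SOME \<xi>. \<xi> \<in> P) (SOME \<eta>. \<eta> \<in> Q))"

end

theory Submission
  imports Defs
begin

text \<open>Let \<open>Psi\<close> send a formal sum \<open>\<Sum> a\<^sub>s \<delta>\<^sub>s\<close> to the function on germs whose value at \<open>g\<close> is the sum of
\<open>a\<^sub>s (r g)\<close> over those \<open>s\<close> with \<open>g = [s, x]\<close>. It is multiplicative, because a nonzero term of
\<open>(a\<^sub>s \<delta>\<^sub>s)(b\<^sub>t \<delta>\<^sub>t)\<close> at \<open>[st, x]\<close> corresponds to the factorization \<open>[s, \<theta>\<^sub>t x][t, x]\<close>.
It maps onto the Steinberg algebra, because a compact open bisection is, near any point of its
range, of the form \<open>[s, U]\<close>. Its kernel is \<open>\<N>\<close>: if \<open>Psi \<xi> = 0\<close> and \<open>\<xi>\<^sub>s y \<noteq> 0\<close>, then some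
\<open>t \<noteq> s\<close> with \<open>\<xi>\<^sub>t y \<noteq> 0\<close> has the same germ at \<open>y\<close>, so modulo \<open>\<N>\<close> the coefficient \<open>\<xi>\<^sub>s\<close> can be moved, near
\<open>y\<close>, to the index \<open>t\<close>; iterating, \<open>\<xi>\<close> cut off to a clopen neighbourhood of \<open>y\<close> lies in \<open>\<N>\<close>.
Compactness passes from local to global in the last two steps.\<close>

section \<open>Inverse semigroups\<close>

locale inv_semigroup =
  fixes mul :: "'s \<Rightarrow> 's \<Rightarrow> 's" (infixl "\<cdot>" 70)
  assumes inv_semigroup: "inverse_semigroup mul"
begin

abbreviation star :: "'s \<Rightarrow> 's" ("_\<^sup>\<star>" [1000] 1000)
  where "s\<^sup>\<star> \<equiv> istar mul s"

abbreviation le :: "'s \<Rightarrow> 's \<Rightarrow> bool" (infix "\<preceq>" 50)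
  where "s \<preceq> t \<equiv> ile mul s t"

lemma assoc: "a \<cdot> b \<cdot> c = a \<cdot> (b \<cdot> c)"
  using inv_semigroup by (simp add: inverse_semigroup_def)

lemma star_ex1: "\<exists>!t. s \<cdot> t \<cdot> s = s \<and> t \<cdot> s \<cdot> t = t"
  using inv_semigroup unfolding inverse_semigroup_def by blast

lemma star_props: "s \<cdot> s\<^sup>\<star> \<cdot> s = s" "s\<^sup>\<star> \<cdot> s \<cdot> s\<^sup>\<star> = s\<^sup>\<star>"
  using theI'[OF star_ex1[of s], folded istar_def] by blast+

lemma star_unique: "s \<cdot> t \<cdot> s = s \<Longrightarrow> t \<cdot> s \<cdot> t = t \<Longrightarrow> s\<^sup>\<star> = t"
  using star_ex1[of s] star_props[of s] by blast

lemma star_star [simp]: "s\<^sup>\<star>\<^sup>\<star> = s"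
  by (rule star_unique) (rule star_props)+

lemma star_idem: "idem mul e \<Longrightarrow> e\<^sup>\<star> = e"
  by (rule star_unique) (simp_all add: idem_def)

lemma idem_star_mul [simp]: "idem mul (s\<^sup>\<star> \<cdot> s)"
  by (metis assoc idem_def star_props(1))

lemma idem_mul_star [simp]: "idem mul (s \<cdot> s\<^sup>\<star>)"
  by (metis idem_star_mul star_star)

text \<open>With \<open>?x\<close> the inverse of \<open>e \<cdot> f\<close>, the element
  \<open>f \<cdot> ?x \<cdot> e\<close> is an inverse of \<open>e \<cdot> f\<close> too, so
  uniqueness makes it equal to \<open>?x\<close>. In that form \<open>?x\<close> is visibly
  idempotent, hence its own inverse, and so \<open>?x\<close> is \<open>e \<cdot> f\<close>.\<close>

lemma idem_mul:
  assumes e: "idem mul e" and f: "idem mul f"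
  shows "idem mul (e \<cdot> f)"
proof -
  let ?x = "(e \<cdot> f)\<^sup>\<star>"
  have ee: "e \<cdot> e = e" "\<And>a. e \<cdot> (e \<cdot> a) = e \<cdot> a" and ff: "f \<cdot> f = f" "\<And>a. f \<cdot> (f \<cdot> a) = f \<cdot> a"
    using e f by (simp_all add: idem_def flip: assoc)
  have p1: "e \<cdot> (f \<cdot> (?x \<cdot> (e \<cdot> f))) = e \<cdot> f" and p2: "?x \<cdot> (e \<cdot> (f \<cdot> ?x)) = ?x"
    using star_props[of "e \<cdot> f"] by (simp_all add: assoc)
  have p3: "?x \<cdot> (e \<cdot> (f \<cdot> (?x \<cdot> a))) = ?x \<cdot> a" for a
    using p2 by (metis assoc)
  have x: "f \<cdot> ?x \<cdot> e = ?x"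
    by (rule star_unique[symmetric]) (use p1 p3 in \<open>simp_all add: assoc ee ff\<close>)
  have "f \<cdot> ?x \<cdot> e \<cdot> (f \<cdot> ?x \<cdot> e) = f \<cdot> ?x \<cdot> e"
    by (simp add: assoc p3)
  then have "idem mul ?x"
    unfolding x by (simp add: idem_def)
  then show ?thesis
    using star_idem[of ?x] by simp
qed

text \<open>As products of idempotents are idempotent, both \<open>e \<cdot> f\<close> and
  \<open>f \<cdot> e\<close> are inverses of \<open>e \<cdot> f\<close>, and the inverse is
  unique.\<close>

lemma idem_commute:
  assumes e: "idem mul e" and f: "idem mul f"
  shows "e \<cdot> f = f \<cdot> e"
proof -
  have ee: "e \<cdot> e = e" "\<And>a. e \<cdot> (e \<cdot> a) = e \<cdot> a" and ff: "f \<cdot> f = f" "\<And>a. f \<cdot> (f \<cdot> a) = f \<cdot> a"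
    using e f by (simp_all add: idem_def flip: assoc)
  have "(e \<cdot> f)\<^sup>\<star> = e \<cdot> f"
    using star_idem idem_mul e f by blast
  moreover have "(e \<cdot> f)\<^sup>\<star> = f \<cdot> e"
    by (rule star_unique)
       (use idem_mul[OF e f] idem_mul[OF f e] in \<open>simp_all add: assoc ee ff idem_def\<close>)
  ultimately show ?thesis by simp
qed

lemma star_mul: "(s \<cdot> t)\<^sup>\<star> = t\<^sup>\<star> \<cdot> s\<^sup>\<star>"
proof -
  have c: "t \<cdot> t\<^sup>\<star> \<cdot> (s\<^sup>\<star> \<cdot> s) = s\<^sup>\<star> \<cdot> s \<cdot> (t \<cdot> t\<^sup>\<star>)"
    by (rule idem_commute) simp_all
  show ?thesis
  proof (rule star_unique)
    have "s \<cdot> t \<cdot> (t\<^sup>\<star> \<cdot> s\<^sup>\<star>) \<cdot> (s \<cdot> t) = s \<cdot> (t \<cdot> t\<^sup>\<star> \<cdot> (s\<^sup>\<star> \<cdot> s)) \<cdot> t"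
      by (simp add: assoc)
    also have "\<dots> = (s \<cdot> s\<^sup>\<star> \<cdot> s) \<cdot> (t \<cdot> t\<^sup>\<star> \<cdot> t)"
      unfolding c by (simp add: assoc)
    finally show "s \<cdot> t \<cdot> (t\<^sup>\<star> \<cdot> s\<^sup>\<star>) \<cdot> (s \<cdot> t) = s \<cdot> t"
      by (simp add: star_props)
    have "t\<^sup>\<star> \<cdot> s\<^sup>\<star> \<cdot> (s \<cdot> t) \<cdot> (t\<^sup>\<star> \<cdot> s\<^sup>\<star>) = t\<^sup>\<star> \<cdot> (s\<^sup>\<star> \<cdot> s \<cdot> (t \<cdot> t\<^sup>\<star>)) \<cdot> s\<^sup>\<star>"
      by (simp add: assoc)
    also have "\<dots> = (t\<^sup>\<star> \<cdot> t \<cdot> t\<^sup>\<star>) \<cdot> (s\<^sup>\<star> \<cdot> s \<cdot> s\<^sup>\<star>)"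
      unfolding c[symmetric] by (simp add: assoc)
    finally show "t\<^sup>\<star> \<cdot> s\<^sup>\<star> \<cdot> (s \<cdot> t) \<cdot> (t\<^sup>\<star> \<cdot> s\<^sup>\<star>) = t\<^sup>\<star> \<cdot> s\<^sup>\<star>"
      by (simp add: star_props)
  qed
qed

lemma idem_conj: "idem mul e \<Longrightarrow> idem mul (s\<^sup>\<star> \<cdot> e \<cdot> s)"
proof -
  assume e: "idem mul e"
  have "s\<^sup>\<star> \<cdot> e \<cdot> s \<cdot> (s\<^sup>\<star> \<cdot> e \<cdot> s) = s\<^sup>\<star> \<cdot> (e \<cdot> (s \<cdot> s\<^sup>\<star>)) \<cdot> e \<cdot> s"
    by (simp add: assoc)
  also have "\<dots> = (s\<^sup>\<star> \<cdot> s \<cdot> s\<^sup>\<star>) \<cdot> (e \<cdot> e) \<cdot> s"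
    unfolding idem_commute[OF e idem_mul_star] by (simp add: assoc)
  finally show ?thesis
    using e by (simp add: idem_def star_props)
qed

text \<open>Because \<open>e\<close> commutes with \<open>s \<cdot> s\<^sup>\<star>\<close>, it can
  be carried across \<open>s\<close> at the price of a conjugation. The order is phrased with
  idempotents on the right, so this is what makes it compatible with products and inverses.\<close>

lemma mul_idem_swap: "idem mul e \<Longrightarrow> e \<cdot> s = s \<cdot> (s\<^sup>\<star> \<cdot> e \<cdot> s)"
proof -
  assume e: "idem mul e"
  have "s \<cdot> (s\<^sup>\<star> \<cdot> e \<cdot> s) = (s \<cdot> s\<^sup>\<star>) \<cdot> e \<cdot> s"
    by (simp add: assoc)
  also have "\<dots> = e \<cdot> (s \<cdot> s\<^sup>\<star> \<cdot> s)"
    unfolding idem_commute[OF idem_mul_star e] by (simp add: assoc)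
  finally show ?thesis
    by (simp add: star_props)
qed

text \<open>Any idempotent on the right may serve as witness, not only the
  \<open>u\<^sup>\<star> \<cdot> u\<close> of the definition.\<close>

lemma le_iff: "u \<preceq> s \<longleftrightarrow> (\<exists>e. idem mul e \<and> u = s \<cdot> e)"
proof
  assume "u \<preceq> s"
  then show "\<exists>e. idem mul e \<and> u = s \<cdot> e"
    unfolding ile_def using idem_star_mul by blast
next
  assume "\<exists>e. idem mul e \<and> u = s \<cdot> e"
  then obtain e where e: "idem mul e" and u: "u = s \<cdot> e" by blast
  have ee: "e \<cdot> e = e" using e by (simp add: idem_def)
  have "s \<cdot> (u\<^sup>\<star> \<cdot> u) = s \<cdot> (e \<cdot> (s\<^sup>\<star> \<cdot> s)) \<cdot> e"
    by (simp add: u star_mul star_idem[OF e] assoc)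
  also have "\<dots> = (s \<cdot> s\<^sup>\<star> \<cdot> s) \<cdot> (e \<cdot> e)"
    unfolding idem_commute[OF e idem_star_mul] by (simp add: assoc)
  finally show "u \<preceq> s"
    by (simp add: ile_def u ee star_props)
qed

lemma le_refl [simp]: "s \<preceq> s"
  by (simp add: ile_def star_props flip: assoc)

lemma le_trans: "u \<preceq> v \<Longrightarrow> v \<preceq> s \<Longrightarrow> u \<preceq> s"
  using assoc idem_mul unfolding le_iff by metis

lemma le_star:
  assumes "u \<preceq> s"
  shows "u\<^sup>\<star> \<preceq> s\<^sup>\<star>"
proof -
  obtain e where e: "idem mul e" "u = s \<cdot> e"
    using assms le_iff by blast
  then have "u\<^sup>\<star> = s\<^sup>\<star> \<cdot> (s\<^sup>\<star>\<^sup>\<star> \<cdot> e \<cdot> s\<^sup>\<star>)"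
    by (simp only: star_mul star_idem mul_idem_swap)
  then show ?thesis
    unfolding le_iff using idem_conj[OF e(1)] by blast
qed

lemma le_mul: "u \<preceq> s \<Longrightarrow> v \<preceq> t \<Longrightarrow> u \<cdot> v \<preceq> s \<cdot> t"
proof -
  assume "u \<preceq> s" "v \<preceq> t"
  then obtain e f where e: "idem mul e" "u = s \<cdot> e" and f: "idem mul f" "v = t \<cdot> f"
    by (auto simp: le_iff)
  have "u \<cdot> v = s \<cdot> (e \<cdot> t) \<cdot> f"
    by (simp add: e f assoc)
  also have "\<dots> = s \<cdot> t \<cdot> (t\<^sup>\<star> \<cdot> e \<cdot> t \<cdot> f)"
    unfolding mul_idem_swap[OF e(1)] by (simp add: assoc)
  finally show ?thesis
    using idem_mul[OF idem_conj[OF e(1)] f(1)] by (auto simp: le_iff)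
qed

end

section \<open>Locally constant functions with compact support\<close>

text \<open>Local compactness puts an open \<open>V\<close> around \<open>x\<close> inside a compact
  \<open>K\<close>; a clopen neighbourhood within \<open>U \<inter> V\<close> is then closed in
  \<open>K\<close>, hence compact.\<close>

lemma zero_dim_compact_open_nbhd:
  assumes "locally_compact_space X" "Hausdorff_space X" "X dim_le 0" "openin X U" "x \<in> U"
  obtains W where "openin X W" "closedin X W" "compactin X W" "x \<in> W" "W \<subseteq> U"
proof -
  have "x \<in> topspace X"
    using assms(4,5) openin_subset by blast
  then obtain V K where V: "openin X V" "compactin X K" "x \<in> V" "V \<subseteq> K"
    using assms(1) unfolding locally_compact_space_def by blast
  have "openin X (U \<inter> V) \<and> x \<in> U \<inter> V"
    using V assms by auto
  then obtain A W where "x \<in> A" "A \<subseteq> W" and W: "closedin X W" "openin X W" "W \<subseteq> U \<inter> V"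
    using assms(3)[unfolded dimension_le_0_neighbourhood_base_of_clopen neighbourhood_base_of]
    by (elim allE impE) auto
  then have "x \<in> W"
    by blast
  have "compactin X W"
    using closed_compactin[OF V(2) _ W(1)] W(3) V(4) by blast
  then show ?thesis
    using that W \<open>x \<in> W\<close> by simp
qed

text \<open>The local-to-global principle used for the kernel and the image of \<open>Psi\<close>.
  The local hypothesis covers every clopen subset of the neighbourhood, so overlapping members of a
  finite cover can be made disjoint. The conclusion speaks of a clopen superset because
  \<open>K\<close> itself need not be open.\<close>

lemma compact_clopen_cover_induct [consumes 1, case_names empty union local]:
  assumes K: "compactin X K"
    and empty: "P {}"
    and union: "\<And>V W. \<lbrakk>openin X V; closedin X V; openin X W; closedin X W; V \<inter> W = {}; P V; P W\<rbrakk>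
                  \<Longrightarrow> P (V \<union> W)"
    and local: "\<And>x. x \<in> K \<Longrightarrow> \<exists>W. openin X W \<and> closedin X W \<and> x \<in> W \<and>
                  (\<forall>V. openin X V \<and> closedin X V \<and> V \<subseteq> W \<longrightarrow> P V)"
  shows "\<exists>W. openin X W \<and> closedin X W \<and> K \<subseteq> W \<and> P W"
proof -
  \<comment> \<open>The hereditary form of \<open>P\<close>; unlike \<open>P\<close> it is preserved
    by unions that are not disjoint.\<close>
  define Q where "Q W \<longleftrightarrow> openin X W \<and> closedin X W \<and>
    (\<forall>V. openin X V \<and> closedin X V \<and> V \<subseteq> W \<longrightarrow> P V)" for W
  have Q_union: "Q (V \<union> W)" if "Q V" "Q W" for V W
  proof -
    have "P U" if U: "openin X U" "closedin X U" "U \<subseteq> V \<union> W" for U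
    proof -
      have "P (U \<inter> V \<union> (U - V))"
      proof (rule union)
        have "openin X (U \<inter> V)" "closedin X (U \<inter> V)" "openin X (U - V)" "closedin X (U - V)"
          using \<open>Q V\<close> U by (auto simp: Q_def intro: openin_diff closedin_diff)
        moreover have "U \<inter> V \<subseteq> V" "U - V \<subseteq> W"
          using U(3) by auto
        ultimately show "P (U \<inter> V)" "P (U - V)"
          using \<open>Q V\<close> \<open>Q W\<close> unfolding Q_def by simp_all
      qed (use \<open>Q V\<close> U in \<open>auto simp: Q_def intro: openin_diff closedin_diff\<close>)
      then show ?thesis by (simp add: Int_Diff_Un)
    qed
    then show ?thesis using that by (auto simp: Q_def)
  qed
  have Q_Union: "Q (\<Union>\<F>)" if "finite \<F>" "\<And>W. W \<in> \<F> \<Longrightarrow> Q W" for \<F>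
    using that
  proof (induction \<F>)
    case empty
    then show ?case using \<open>P {}\<close> by (auto simp: Q_def)
  next
    case (insert W \<F>)
    then show ?case using Q_union by simp
  qed
  have "\<exists>W. Q W \<and> x \<in> W" if "x \<in> K" for x
    using local[OF that] unfolding Q_def by metis
  then have "K \<subseteq> \<Union> (Collect Q)"
    by blast
  then obtain \<F> where F: "finite \<F>" "\<F> \<subseteq> Collect Q" and "K \<subseteq> \<Union>\<F>"
    using compactinD[OF K, of "Collect Q"] by (auto simp: Q_def)
  have "Q (\<Union>\<F>)"
    using Q_Union F by blast
  with \<open>K \<subseteq> \<Union>\<F>\<close> show ?thesis
    unfolding Q_def by blast
qed

lemma AR_spaceI:
  assumes "\<And>x. f x \<noteq> 0 \<Longrightarrow> x \<in> topspace X"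
    and "\<And>x. x \<in> topspace X \<Longrightarrow> \<exists>U c. openin X U \<and> x \<in> U \<and> (\<forall>y\<in>U. f y = c)"
    and "compactin X K" "\<And>x. f x \<noteq> 0 \<Longrightarrow> x \<in> K"
  shows "f \<in> AR_space X"
  unfolding AR_space_def
proof (intro CollectI conjI ballI allI impI)
  fix x assume "x \<in> topspace X"
  then obtain U c where "openin X U" "x \<in> U" and c: "\<forall>y\<in>U. f y = c"
    using assms(2) by blast
  moreover have "\<forall>y\<in>U. f y = f x"
    using c \<open>x \<in> U\<close> by metis
  ultimately show "\<exists>U. openin X U \<and> x \<in> U \<and> (\<forall>y\<in>U. f y = f x)"
    by blast
qed (use assms(1,3,4) in blast)+

lemma AR_spaceE:
  assumes "f \<in> AR_space X" "x \<in> topspace X"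
  obtains U c where "openin X U" "x \<in> U" "\<And>y. y \<in> U \<Longrightarrow> f y = c"
  using assms unfolding AR_space_def by blast

lemma AR_spaceD:
  assumes "f \<in> AR_space X"
  shows "f x \<noteq> 0 \<Longrightarrow> x \<in> topspace X"
    and "\<exists>K. compactin X K \<and> {x. f x \<noteq> 0} \<subseteq> K"
  using assms unfolding AR_space_def by blast+

text \<open>An arbitrary binary \<open>F\<close> treats sums, differences and scalar multiples at
  once; \<open>F 0 0 = 0\<close> confines the support to the union of two compact sets.\<close>

lemma AR_space_combine:
  assumes f: "f \<in> AR_space X" and g: "g \<in> AR_space X" and F: "F 0 0 = 0"
  shows "(\<lambda>x. F (f x) (g x)) \<in> AR_space X"
proof -
  obtain K where K: "compactin X K" "{x. f x \<noteq> 0} \<subseteq> K"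
    using AR_spaceD(2)[OF f] by blast
  obtain L where L: "compactin X L" "{x. g x \<noteq> 0} \<subseteq> L"
    using AR_spaceD(2)[OF g] by blast
  have nz: "f x \<noteq> 0 \<or> g x \<noteq> 0" if "F (f x) (g x) \<noteq> 0" for x
    using that F by metis
  show ?thesis
  proof (rule AR_spaceI)
    show "compactin X (K \<union> L)"
      using K L compactin_Un by blast
    fix x assume "F (f x) (g x) \<noteq> 0"
    then show "x \<in> topspace X" "x \<in> K \<union> L"
      using nz AR_spaceD(1)[OF f] AR_spaceD(1)[OF g] K L by blast+
  next
    fix x assume x: "x \<in> topspace X"
    obtain U c where U: "openin X U" "x \<in> U" "\<And>y. y \<in> U \<Longrightarrow> f y = c"
      using AR_spaceE[OF f x] by blast
    obtain V d where V: "openin X V" "x \<in> V" "\<And>y. y \<in> V \<Longrightarrow> g y = d"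
      using AR_spaceE[OF g x] by blast
    show "\<exists>U c. openin X U \<and> x \<in> U \<and> (\<forall>y\<in>U. F (f y) (g y) = c)"
      using U V by (intro exI[of _ "U \<inter> V"] exI[of _ "F c d"]) auto
  qed
qed

lemma AR_space_zero: "(\<lambda>_. 0) \<in> AR_space X"
  by (rule AR_spaceI[of _ _ "{}"]) (use openin_topspace in auto)

lemma AR_space_cut:
  assumes f: "f \<in> AR_space X" and W: "openin X W" "closedin X W"
  shows "(\<lambda>x. if x \<in> W then f x else 0) \<in> AR_space X"
proof -
  obtain K where K: "compactin X K" "{x. f x \<noteq> 0} \<subseteq> K"
    using AR_spaceD(2)[OF f] by blast
  show ?thesis
  proof (rule AR_spaceI[OF _ _ K(1)])
    fix x assume x: "x \<in> topspace X"
    obtain U c where U: "openin X U" "x \<in> U" "\<And>y. y \<in> U \<Longrightarrow> f y = c"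
      using AR_spaceE[OF f x] by blast
    show "\<exists>U c. openin X U \<and> x \<in> U \<and> (\<forall>y\<in>U. (if y \<in> W then f y else 0) = c)"
    proof (cases "x \<in> W")
      case True
      then show ?thesis
        using U W by (intro exI[of _ "U \<inter> W"] exI[of _ c]) auto
    next
      case False
      then show ?thesis
        using U W by (intro exI[of _ "U - W"] exI[of _ 0]) (auto intro: openin_diff)
    qed
  qed (use K AR_spaceD(1)[OF f] in \<open>auto split: if_splits\<close>)
qed

lemma AR_space_indicator:
  assumes "openin X W" "closedin X W" "compactin X W"
  shows "(\<lambda>x. if x \<in> W then c else 0) \<in> AR_space X"
proof (rule AR_spaceI[OF _ _ assms(3)])
  fix x assume x: "x \<in> topspace X"
  show "\<exists>U d. openin X U \<and> x \<in> U \<and> (\<forall>y\<in>U. (if y \<in> W then c else 0) = d)"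
  proof (cases "x \<in> W")
    case True
    then show ?thesis
      using assms by (intro exI[of _ W] exI[of _ c]) auto
  next
    case False
    then show ?thesis
      using x assms by (intro exI[of _ "topspace X - W"] exI[of _ 0]) auto
  qed
qed (use openin_subset[OF assms(1)] in \<open>auto split: if_splits\<close>)

section \<open>The groupoid of germs\<close>

locale partial_action = inv_semigroup mul
  for mul :: "'s \<Rightarrow> 's \<Rightarrow> 's" (infixl "\<cdot>" 70) +
  fixes X :: "'x topology" and Xs :: "'s \<Rightarrow> 'x set" and th :: "'s \<Rightarrow> 'x \<Rightarrow> 'x"
  assumes loc_compact: "locally_compact_space X" and hausdorff: "Hausdorff_space X"
    and zero_dim: "X dim_le 0"
    and partial_action: "top_partial_action mul X Xs th"
begin

section \<open>The partial bijections of the action\<close>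

lemmas partial_action_conjs = partial_action[unfolded top_partial_action_def]

lemma open_Xs: "openin X (Xs s)"
  using partial_action_conjs[THEN conjunct1] by blast

lemma Xs_topspace: "x \<in> Xs s \<Longrightarrow> x \<in> topspace X"
  using open_Xs openin_subset by blast

lemma th_homeo: "homeomorphic_map (subtopology X (Xs (s\<^sup>\<star>))) (subtopology X (Xs s)) (th s)"
  using partial_action_conjs[THEN conjunct2, THEN conjunct1] by blast

lemma th_in: "x \<in> Xs (s\<^sup>\<star>) \<Longrightarrow> th s x \<in> Xs s"
  using homeomorphic_imp_surjective_map[OF th_homeo[of s]] Xs_topspace by auto

lemma th_star_in: "y \<in> Xs s \<Longrightarrow> th (s\<^sup>\<star>) y \<in> Xs (s\<^sup>\<star>)"
  using th_in[of y "s\<^sup>\<star>"] by simp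

lemma th_star_th: "x \<in> Xs (s\<^sup>\<star>) \<Longrightarrow> th (s\<^sup>\<star>) (th s x) = x"
  using partial_action_conjs[THEN conjunct2, THEN conjunct2, THEN conjunct1] by blast

lemma th_th_star: "y \<in> Xs s \<Longrightarrow> th s (th (s\<^sup>\<star>) y) = y"
  using th_star_th[of y "s\<^sup>\<star>"] by simp

lemma open_th_preimage: "openin X U \<Longrightarrow> openin X {x \<in> Xs (s\<^sup>\<star>). th s x \<in> U}"
proof -
  assume U: "openin X U"
  have c: "continuous_map (subtopology X (Xs (s\<^sup>\<star>))) X (th s)"
    using homeomorphic_imp_continuous_map[OF th_homeo] continuous_map_in_subtopology by blast
  have "topspace (subtopology X (Xs (s\<^sup>\<star>))) = Xs (s\<^sup>\<star>)"
    using Xs_topspace by auto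
  then have "openin (subtopology X (Xs (s\<^sup>\<star>))) {x \<in> Xs (s\<^sup>\<star>). th s x \<in> U}"
    using openin_continuous_map_preimage[OF c U] by simp
  then show ?thesis
    using openin_trans_full open_Xs by blast
qed

lemma open_th_star_preimage: "openin X U \<Longrightarrow> openin X {y \<in> Xs s. th (s\<^sup>\<star>) y \<in> U}"
  using open_th_preimage[of U "s\<^sup>\<star>"] by simp

lemma th_comp:
  assumes "x \<in> Xs (t\<^sup>\<star>)" "th t x \<in> Xs (s\<^sup>\<star>)"
  shows "x \<in> Xs ((s \<cdot> t)\<^sup>\<star>)" "th (s \<cdot> t) x = th s (th t x)"
  using partial_action_conjs[THEN conjunct2, THEN conjunct2, THEN conjunct2, THEN conjunct1] assms
  by blast+

lemma th_le:
  assumes "u \<preceq> s" "x \<in> Xs (u\<^sup>\<star>)"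
  shows "x \<in> Xs (s\<^sup>\<star>)" "th s x = th u x"
proof -
  have "Xs (u\<^sup>\<star>) \<subseteq> Xs (s\<^sup>\<star>) \<and> (\<forall>x\<in>Xs (u\<^sup>\<star>). th u x = th s x)"
    using partial_action_conjs[THEN conjunct2, THEN conjunct2, THEN conjunct2, THEN conjunct2,
      THEN conjunct1] assms by blast
  with assms show "x \<in> Xs (s\<^sup>\<star>)" "th s x = th u x" by auto
qed

lemma Xs_mono: "r \<preceq> s \<Longrightarrow> Xs r \<subseteq> Xs s"
  using th_le(1)[OF le_star] by fastforce

text \<open>Since \<open>e\<close> is its own inverse, applying \<open>th e\<close> twice gives
  \<open>x\<close>; since \<open>e \<cdot> e = e\<close>, it also gives
  \<open>th e x\<close>.\<close>

lemma th_idem: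
  assumes e: "idem mul e" and x: "x \<in> Xs e"
  shows "th e x = x"
proof -
  have ee: "e\<^sup>\<star> = e" "e \<cdot> e = e"
    using e star_idem by (auto simp: idem_def)
  have "th e (th e x) = x" "th e x \<in> Xs e"
    using th_star_th[of x e] th_in[of x e] x by (simp_all add: ee)
  then show ?thesis
    using th_comp(2)[of x e e] x by (simp add: ee)
qed

lemma Xs_star_mul: "x \<in> Xs (s\<^sup>\<star>) \<Longrightarrow> x \<in> Xs (s\<^sup>\<star> \<cdot> s)"
  using th_comp(1)[of x s "s\<^sup>\<star>"] th_in[of x s] by (simp add: star_mul)

text \<open>The bound is \<open>u \<cdot> (v\<^sup>\<star> \<cdot> v)\<close>. Both \<open>u\<close>
  and \<open>v\<close> are \<open>t\<close> times an idempotent, and idempotents commute, so this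
  product equals \<open>v \<cdot> (u\<^sup>\<star> \<cdot> u)\<close>. The point \<open>x\<close>
  stays in the domain because idempotents act as identities.\<close>

lemma common_lower_bound:
  assumes u: "u \<preceq> t" "x \<in> Xs (u\<^sup>\<star>)" and v: "v \<preceq> t" "x \<in> Xs (v\<^sup>\<star>)"
  obtains w where "w \<preceq> u" "w \<preceq> v" "x \<in> Xs (w\<^sup>\<star>)"
proof
  let ?e = "u\<^sup>\<star> \<cdot> u" and ?f = "v\<^sup>\<star> \<cdot> v"
  have x: "x \<in> Xs (?f\<^sup>\<star>)" "th ?f x = x"
    using Xs_star_mul[OF v(2)] by (simp_all add: star_idem th_idem)
  show "x \<in> Xs ((u \<cdot> ?f)\<^sup>\<star>)"
    using th_comp(1)[of x ?f u] x u(2) by simp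
  show "u \<cdot> ?f \<preceq> u"
    using le_iff idem_star_mul by blast
  have ue: "t \<cdot> ?e = u" and vf: "t \<cdot> ?f = v"
    by (rule u(1)[unfolded ile_def, symmetric], rule v(1)[unfolded ile_def, symmetric])
  have "u \<cdot> ?f = t \<cdot> ?e \<cdot> ?f"
    by (simp only: ue)
  also have "\<dots> = t \<cdot> (?f \<cdot> ?e)"
    using idem_commute[of ?e ?f] by (simp only: assoc idem_star_mul)
  also have "\<dots> = t \<cdot> ?f \<cdot> ?e"
    by (simp only: assoc)
  also have "\<dots> = v \<cdot> ?e"
    by (simp only: vf)
  finally show "u \<cdot> ?f \<preceq> v"
    using le_iff idem_star_mul by blast
qed

section \<open>Germs, their sources, ranges and products\<close>

abbreviation gm :: "'s \<Rightarrow> 'x \<Rightarrow> ('s \<times> 'x) set" where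
  "gm \<equiv> germ mul Xs"

abbreviation gs :: "('s \<times> 'x) set set" where
  "gs \<equiv> germs mul Xs"

abbreviation gtop :: "('s \<times> 'x) set topology" where
  "gtop \<equiv> germ_top mul X Xs"

lemma mem_germ:
  "(t, y) \<in> gm s x \<longleftrightarrow> y = x \<and> x \<in> Xs (t\<^sup>\<star>) \<and> (\<exists>u. u \<preceq> s \<and> u \<preceq> t \<and> x \<in> Xs (u\<^sup>\<star>))"
  by (simp add: germ_def)

lemma germ_self: "x \<in> Xs (s\<^sup>\<star>) \<Longrightarrow> (s, x) \<in> gm s x"
  unfolding mem_germ using le_refl by blast

text \<open>This is transitivity of the germ relation: \<open>u\<close> and the witness for a member
  of \<open>gm s x\<close> both lie below \<open>s\<close>, so they have a common lower bound that
  is still defined at \<open>x\<close>.\<close>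

lemma germ_subset:
  assumes "u \<preceq> s" "u \<preceq> t" "x \<in> Xs (u\<^sup>\<star>)"
  shows "gm s x \<subseteq> gm t x"
proof
  fix p assume "p \<in> gm s x"
  then obtain r v where p: "p = (r, x)" "x \<in> Xs (r\<^sup>\<star>)" and v: "v \<preceq> s" "v \<preceq> r" "x \<in> Xs (v\<^sup>\<star>)"
    by (cases p) (auto simp: mem_germ)
  obtain w where "w \<preceq> u" "w \<preceq> v" "x \<in> Xs (w\<^sup>\<star>)"
    using common_lower_bound[OF assms(1,3) v(1,3)] by blast
  then show "p \<in> gm t x"
    unfolding p mem_germ using p(2) le_trans assms(2) v(2) by blast
qed

lemma germ_eqI: "u \<preceq> s \<Longrightarrow> u \<preceq> t \<Longrightarrow> x \<in> Xs (u\<^sup>\<star>) \<Longrightarrow> gm s x = gm t x"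
  using germ_subset by blast

lemma germ_eqD:
  assumes "gm s x = gm t y" "x \<in> Xs (s\<^sup>\<star>)"
  shows "x = y" "\<exists>u. u \<preceq> s \<and> u \<preceq> t \<and> x \<in> Xs (u\<^sup>\<star>)"
proof -
  have "(s, x) \<in> gm t y"
    using assms germ_self by blast
  then show "x = y" "\<exists>u. u \<preceq> s \<and> u \<preceq> t \<and> x \<in> Xs (u\<^sup>\<star>)"
    by (auto simp: mem_germ)
qed

lemma germE:
  assumes "(t, y) \<in> gm s x"
  shows "y = x" "x \<in> Xs (t\<^sup>\<star>)" "gm t x = gm s x"
proof -
  obtain u where u: "y = x" "x \<in> Xs (t\<^sup>\<star>)" "u \<preceq> s" "u \<preceq> t" "x \<in> Xs (u\<^sup>\<star>)"
    using assms unfolding mem_germ by blast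
  then show "y = x" "x \<in> Xs (t\<^sup>\<star>)" "gm t x = gm s x"
    using germ_eqI[OF u(4,3,5)] by simp_all
qed

text \<open>Source, range and product of germs pick a representative by \<open>SOME\<close>;
  whatever is picked has the same base point and the same germ.\<close>

lemma germ_some:
  assumes "x \<in> Xs (s\<^sup>\<star>)"
  obtains t where "(SOME p. p \<in> gm s x) = (t, x)" "x \<in> Xs (t\<^sup>\<star>)" "gm t x = gm s x"
proof -
  have "(SOME p. p \<in> gm s x) \<in> gm s x"
    using germ_self[OF assms] by (rule someI)
  moreover obtain t y where "(SOME p. p \<in> gm s x) = (t, y)"
    by fastforce
  ultimately show thesis
    using that germE by metis
qed

lemma gsrc_germ [simp]: "x \<in> Xs (s\<^sup>\<star>) \<Longrightarrow> gsrc (gm s x) = x"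
  by (erule germ_some) (simp add: gsrc_def)

lemma germ_eq_th: "gm s x = gm t x \<Longrightarrow> x \<in> Xs (s\<^sup>\<star>) \<Longrightarrow> th s x = th t x"
  using germ_eqD(2) th_le(2) by metis

lemma grng_germ [simp]: "x \<in> Xs (s\<^sup>\<star>) \<Longrightarrow> grng th (gm s x) = th s x"
  by (rule germ_some[of x s]) (auto simp: grng_def dest: germ_eq_th)

lemma germ_in_gs: "x \<in> Xs (s\<^sup>\<star>) \<Longrightarrow> gm s x \<in> gs"
  unfolding germs_def by blast

lemma gsE:
  assumes "g \<in> gs"
  obtains s x where "g = gm s x" "x \<in> Xs (s\<^sup>\<star>)"
  using assms unfolding germs_def by blast

lemma mem_gs_iff:
  assumes "g \<in> gs"
  shows "(s, gsrc g) \<in> g \<longleftrightarrow> gsrc g \<in> Xs (s\<^sup>\<star>) \<and> g = gm s (gsrc g)"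
proof -
  obtain t x where g: "g = gm t x" "x \<in> Xs (t\<^sup>\<star>)"
    using gsE[OF assms] .
  show ?thesis
    using germE[of s x t x] germ_self[of x s] g by auto
qed

text \<open>The chosen representatives \<open>s'\<close>, \<open>t'\<close> share lower bounds
  \<open>u\<close>, \<open>v\<close> with \<open>s\<close>, \<open>t\<close>, and
  \<open>u \<cdot> v\<close> lies below both products and is defined at \<open>x\<close>.\<close>

lemma gmul_germ:
  assumes "x \<in> Xs (t\<^sup>\<star>)" "th t x \<in> Xs (s\<^sup>\<star>)"
  shows "gmul mul Xs (gm s (th t x)) (gm t x) = gm (s \<cdot> t) x"
proof -
  obtain s' where s': "(SOME p. p \<in> gm s (th t x)) = (s', th t x)" "gm s' (th t x) = gm s (th t x)"
    "th t x \<in> Xs (s'\<^sup>\<star>)"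
    using germ_some[OF assms(2)] by metis
  obtain t' where t': "(SOME p. p \<in> gm t x) = (t', x)" "gm t' x = gm t x" "x \<in> Xs (t'\<^sup>\<star>)"
    using germ_some[OF assms(1)] by metis
  obtain u where u: "u \<preceq> s'" "u \<preceq> s" "th t x \<in> Xs (u\<^sup>\<star>)"
    using germ_eqD(2)[OF s'(2,3)] by blast
  obtain v where v: "v \<preceq> t'" "v \<preceq> t" "x \<in> Xs (v\<^sup>\<star>)"
    using germ_eqD(2)[OF t'(2,3)] by blast
  have "x \<in> Xs ((u \<cdot> v)\<^sup>\<star>)"
    using th_comp(1)[OF v(3)] u(3) th_le(2)[OF v(2,3)] by simp
  then have "gm (s' \<cdot> t') x = gm (s \<cdot> t) x"
    using germ_eqI le_mul u v by blast
  then show ?thesis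
    by (simp add: gmul_def s'(1) t'(1))
qed

section \<open>The topology of the groupoid and its compact open bisections\<close>

lemma Union_basic_open_germs: "\<Union>{{gm s x | x. x \<in> U} | s U. openin X U \<and> U \<subseteq> Xs (s\<^sup>\<star>)} = gs"
  unfolding germs_def using open_Xs by blast

lemma topspace_gtop: "topspace gtop = gs"
  using Union_basic_open_germs by (simp add: germ_top_def)

lemma open_germs: "openin X U \<Longrightarrow> U \<subseteq> Xs (s\<^sup>\<star>) \<Longrightarrow> openin gtop {gm s x | x. x \<in> U}"
  unfolding germ_top_def by (rule topology_generated_by_Basis) blast

text \<open>The sets \<open>[s, U]\<close> are only declared as generators of the topology. They
  form a basis because near a germ common to \<open>[s, U]\<close> and \<open>[t, V]\<close> both
  \<open>s\<close> and \<open>t\<close> may be replaced by a common lower bound; this is the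
  intersection case of the induction.\<close>

lemma gtop_basis:
  assumes "openin gtop B" "g \<in> B"
  shows "\<exists>s U. openin X U \<and> U \<subseteq> Xs (s\<^sup>\<star>) \<and> g \<in> {gm s x | x. x \<in> U} \<and> {gm s x | x. x \<in> U} \<subseteq> B"
proof -
  have "generate_topology_on {{gm s x | x. x \<in> U} | s U. openin X U \<and> U \<subseteq> Xs (s\<^sup>\<star>)} B"
    using assms(1) unfolding germ_top_def by (rule openin_topology_generated_by)
  then show ?thesis
    using assms(2)
  proof induction
    case Empty
    then show ?case by simp
  next
    case (Int A B)
    obtain s U where
      U: "openin X U" "U \<subseteq> Xs (s\<^sup>\<star>)" "g \<in> {gm s x | x. x \<in> U}" "{gm s x | x. x \<in> U} \<subseteq> A"
      using Int.IH(1)[OF IntD1[OF Int.prems]] by (elim exE conjE)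
    obtain t V where
      V: "openin X V" "V \<subseteq> Xs (t\<^sup>\<star>)" "g \<in> {gm t x | x. x \<in> V}" "{gm t x | x. x \<in> V} \<subseteq> B"
      using Int.IH(2)[OF IntD2[OF Int.prems]] by (elim exE conjE)
    obtain x y where x: "g = gm s x" "x \<in> U" and y: "g = gm t y" "y \<in> V"
      using U(3) V(3) by blast
    have "gm s x = gm t y" "x \<in> Xs (s\<^sup>\<star>)"
      using x y U by auto
    from germ_eqD[OF this] obtain u where u: "x = y" "u \<preceq> s" "u \<preceq> t" "x \<in> Xs (u\<^sup>\<star>)"
      by blast
    have su: "gm u z = gm s z" and tu: "gm u z = gm t z" if "z \<in> Xs (u\<^sup>\<star>)" for z
      using germ_eqI[OF le_refl] u that by blast+
    \<comment> \<open>On the domain of \<open>u\<close> the germs of \<open>s\<close>,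
      \<open>t\<close> and \<open>u\<close> coincide, so \<open>[u, ?W]\<close> lies in both basic
      sets.\<close>
    let ?W = "U \<inter> V \<inter> Xs (u\<^sup>\<star>)"
    show ?case
    proof (intro exI conjI)
      show "openin X ?W" using U V open_Xs by blast
      show "?W \<subseteq> Xs (u\<^sup>\<star>)" by blast
      have "g = gm u x" "x \<in> ?W"
        using su u x y by auto
      then show "g \<in> {gm u z | z. z \<in> ?W}" by blast
      have "gm u z \<in> A \<inter> B" if "z \<in> ?W" for z
      proof -
        have "gm s z \<in> A" "gm t z \<in> B"
          using that U(4) V(4) by blast+
        then show ?thesis using su[of z] tu[of z] that by simp
      qed
      then show "{gm u z | z. z \<in> ?W} \<subseteq> A \<inter> B" by blast
    qed
  next
    case (UN K)
    then obtain k where k: "k \<in> K" "g \<in> k" by blast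
    then obtain s U where U: "openin X U" "U \<subseteq> Xs (s\<^sup>\<star>)" "g \<in> {gm s x | x. x \<in> U}"
      and sub: "{gm s x | x. x \<in> U} \<subseteq> k"
      using UN.IH[OF k] by (elim exE conjE)
    have "{gm s x | x. x \<in> U} \<subseteq> \<Union>K"
      by (rule subset_trans[OF sub Union_upper[OF k(1)]])
    with U show ?case
      by (intro exI[of _ s] exI[of _ U] conjI)
  next
    case (Basis B)
    then obtain s U where U: "B = {gm s x | x. x \<in> U}" "openin X U" "U \<subseteq> Xs (s\<^sup>\<star>)"
      by blast
    show ?case
      using U(2,3) Basis.prems unfolding U(1) by (intro exI[of _ s] exI[of _ U] conjI subset_refl)
  qed
qed

lemma continuous_grng: "continuous_map gtop X (grng th)"
  unfolding continuous_map
proof (intro conjI allI impI)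
  show "grng th ` topspace gtop \<subseteq> topspace X"
    unfolding topspace_gtop using Xs_topspace[OF th_in] by (auto elim!: gsE)
  fix U assume U: "openin X U"
  let ?P = "\<lambda>s. {x \<in> Xs (s\<^sup>\<star>). th s x \<in> U}"
  have "openin gtop (\<Union>s. {gm s x | x. x \<in> ?P s})"
    using open_germs[OF open_th_preimage[OF U]] by (intro openin_Union) auto
  also have "(\<Union>s. {gm s x | x. x \<in> ?P s}) = {g \<in> topspace gtop. grng th g \<in> U}"
  proof (intro equalityI subsetI)
    fix g assume "g \<in> {g \<in> topspace gtop. grng th g \<in> U}"
    moreover from this obtain s x where "g = gm s x" "x \<in> Xs (s\<^sup>\<star>)"
      unfolding topspace_gtop by (auto elim: gsE)
    ultimately show "g \<in> (\<Union>s. {gm s x | x. x \<in> ?P s})"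
      by auto
  qed (auto simp: topspace_gtop germ_in_gs)
  finally show "openin gtop {g \<in> topspace gtop. grng th g \<in> U}" .
qed

text \<open>The map inverts the range map on the germs of \<open>s\<close>. A point \<open>y\<close>
  is sent into \<open>[t, U]\<close> exactly when its source lies in \<open>U\<close> and in the
  domain of some common lower bound of \<open>s\<close> and \<open>t\<close>, which is an open
  condition.\<close>

lemma continuous_section:
  "continuous_map (subtopology X (Xs s)) gtop (\<lambda>y. gm s (th (s\<^sup>\<star>) y))"
proof -
  let ?f = "\<lambda>y. gm s (th (s\<^sup>\<star>) y)"
  let ?X = "subtopology X (Xs s)"
  have top: "topspace ?X = Xs s"
    using Xs_topspace by auto
  have "openin ?X (?f -` {gm t x | x. x \<in> U} \<inter> topspace ?X)"
    if U: "openin X U" "U \<subseteq> Xs (t\<^sup>\<star>)" for t U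
  proof -
    let ?V = "U \<inter> (\<Union>u\<in>{u. u \<preceq> s \<and> u \<preceq> t}. Xs (u\<^sup>\<star>))"
    have "?f y \<in> {gm t x | x. x \<in> U} \<longleftrightarrow> th (s\<^sup>\<star>) y \<in> ?V" if y: "y \<in> Xs s" for y
    proof
      assume "?f y \<in> {gm t x | x. x \<in> U}"
      then obtain x where x: "x \<in> U" "?f y = gm t x"
        by blast
      show "th (s\<^sup>\<star>) y \<in> ?V"
        using germ_eqD[OF x(2) th_star_in[OF y]] x(1) by blast
    next
      assume "th (s\<^sup>\<star>) y \<in> ?V"
      then obtain u where "th (s\<^sup>\<star>) y \<in> U" "u \<preceq> s" "u \<preceq> t" "th (s\<^sup>\<star>) y \<in> Xs (u\<^sup>\<star>)"
        by blast
      with germ_eqI[OF this(2-4)] show "?f y \<in> {gm t x | x. x \<in> U}"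
        by (intro CollectI exI[of _ "th (s\<^sup>\<star>) y"] conjI)
    qed
    then have eq: "?f -` {gm t x | x. x \<in> U} \<inter> topspace ?X = {y \<in> Xs s. th (s\<^sup>\<star>) y \<in> ?V}"
      unfolding top by (intro set_eqI) (simp only: Int_iff vimage_eq mem_Collect_eq conj_commute cong: conj_cong)
    have "openin X ?V"
      using U open_Xs by blast
    then have "openin X {y \<in> Xs s. th (s\<^sup>\<star>) y \<in> ?V}"
      by (rule open_th_star_preimage)
    then show ?thesis
      unfolding eq by (auto simp: openin_subtopology)
  qed
  then have "\<forall>U. U \<in> {{gm s x | x. x \<in> U} | s U. openin X U \<and> U \<subseteq> Xs (s\<^sup>\<star>)} \<longrightarrow>
      openin ?X (?f -` U \<inter> topspace ?X)"
    by blast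
  moreover have "?f ` topspace ?X \<subseteq> gs"
    unfolding top using germ_in_gs[OF th_star_in] by blast
  ultimately show ?thesis
    unfolding germ_top_def continuous_on_generated_topo_iff Union_basic_open_germs by simp
qed

text \<open>This is \<open>[s, U]\<close> for \<open>U\<close> the preimage of \<open>V\<close>
  under \<open>th s\<close>. It is parametrized by ranges because a coefficient of
  \<open>\<delta>\<^sub>s\<close> is a function on \<open>Xs s\<close>, the range side.\<close>

definition bis :: "'s \<Rightarrow> 'x set \<Rightarrow> ('s \<times> 'x) set set" where
  "bis s V = {gm s x | x. x \<in> Xs (s\<^sup>\<star>) \<and> th s x \<in> V}"

text \<open>Compactness holds since \<open>bis s V\<close> is the image of \<open>V\<close> under
  the continuous section; injectivity of the range map is that of \<open>th s\<close> on its
  domain.\<close>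

lemma compact_open_bis:
  assumes V: "openin X V" "compactin X V" "V \<subseteq> Xs s"
  shows "compact_open_bisection mul X Xs th (bis s V)"
  unfolding compact_open_bisection_def
proof (intro conjI)
  show "bis s V \<subseteq> gs"
    by (auto simp: bis_def germ_in_gs)
  show "openin gtop (bis s V)"
    using open_germs[OF open_th_preimage[OF V(1)], of s s] by (simp add: bis_def subset_iff)
  have "bis s V = (\<lambda>y. gm s (th (s\<^sup>\<star>) y)) ` V"
  proof (intro equalityI subsetI)
    fix g assume "g \<in> bis s V"
    then obtain x where "g = gm s x" "x \<in> Xs (s\<^sup>\<star>)" "th s x \<in> V"
      by (auto simp: bis_def)
    then show "g \<in> (\<lambda>y. gm s (th (s\<^sup>\<star>) y)) ` V"
      by (intro image_eqI[of _ _ "th s x"]) (simp_all add: th_star_th)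
  next
    fix g assume "g \<in> (\<lambda>y. gm s (th (s\<^sup>\<star>) y)) ` V"
    then obtain y where y: "g = gm s (th (s\<^sup>\<star>) y)" "y \<in> V"
      by blast
    then have "y \<in> Xs s"
      using V(3) by blast
    then show "g \<in> bis s V"
      unfolding bis_def y(1) using th_star_in th_th_star y(2)
      by (intro CollectI exI[of _ "th (s\<^sup>\<star>) y"]) simp
  qed
  moreover have "compactin (subtopology X (Xs s)) V"
    using V by (simp add: compactin_subtopology)
  ultimately show "compactin gtop (bis s V)"
    using image_compactin continuous_section by metis
  show "inj_on gsrc (bis s V)"
    by (auto simp: bis_def inj_on_def)
  show "inj_on (grng th) (bis s V)"
  proof (rule inj_onI)
    fix g h assume "g \<in> bis s V" "h \<in> bis s V" and eq: "grng th g = grng th h"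
    then obtain x y where x: "g = gm s x" "x \<in> Xs (s\<^sup>\<star>)" and y: "h = gm s y" "y \<in> Xs (s\<^sup>\<star>)"
      by (auto simp: bis_def)
    then have "th s x = th s y"
      using eq by simp
    then have "x = y"
      using th_star_th x(2) y(2) by metis
    then show "g = h"
      using x y by simp
  qed
qed

end

section \<open>The evaluation map\<close>

definition cutoff :: "'x set \<Rightarrow> ('x \<Rightarrow> 'r::zero) \<Rightarrow> 'x \<Rightarrow> 'r" where
  "cutoff V f = (\<lambda>x. if x \<in> V then f x else 0)"

definition single :: "'s \<Rightarrow> ('x \<Rightarrow> 'r::zero) \<Rightarrow> 's \<Rightarrow> 'x \<Rightarrow> 'r" where
  "single s a = (\<lambda>t x. if t = s then a x else 0)"

lemma single_apply: "single s a t = (if t = s then a else (\<lambda>_. 0))"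
  by (auto simp: single_def)

lemma cutoff_zero [simp]: "cutoff V (\<lambda>_. 0) = (\<lambda>_. 0)"
  by (simp add: cutoff_def)

lemma cutoff_nonzero: "cutoff V f x \<noteq> 0 \<Longrightarrow> x \<in> V \<and> f x \<noteq> 0"
  by (auto simp: cutoff_def split: if_splits)

context partial_action
begin

lemmas compact_open_nbhd = zero_dim_compact_open_nbhd[OF loc_compact hausdorff zero_dim]

abbreviation D :: "'s \<Rightarrow> ('x \<Rightarrow> 'r::comm_ring_1) set" where
  "D \<equiv> dualD X Xs"

abbreviation L :: "('s \<Rightarrow> 'x \<Rightarrow> 'r::comm_ring_1) set" where
  "L \<equiv> cpL (dualD X Xs)"

abbreviation N :: "('s \<Rightarrow> 'x \<Rightarrow> 'r::comm_ring_1) set" where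
  "N \<equiv> cpN mul (dualD X Xs)"

abbreviation A :: "(('s \<times> 'x) set \<Rightarrow> 'r::comm_ring_1) set" where
  "A \<equiv> steinberg mul X Xs th"

section \<open>The ideals of coefficients, finite formal sums and the subgroup
  \<open>N\<close>\<close>

lemma D_zero: "(\<lambda>_. 0) \<in> D s"
  by (simp add: dualD_def AR_space_zero)

lemma D_nonzero: "a \<in> D s \<Longrightarrow> a x \<noteq> 0 \<Longrightarrow> x \<in> Xs s"
  by (auto simp: dualD_def)

lemma D_AR: "a \<in> D s \<Longrightarrow> a \<in> AR_space X"
  by (simp add: dualD_def)

lemma DI: "a \<in> AR_space X \<Longrightarrow> (\<And>x. a x \<noteq> 0 \<Longrightarrow> x \<in> Xs s) \<Longrightarrow> a \<in> D s"
  by (auto simp: dualD_def)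

lemma D_combine: "F 0 0 = 0 \<Longrightarrow> a \<in> D s \<Longrightarrow> b \<in> D s \<Longrightarrow> (\<lambda>x. F (a x) (b x)) \<in> D s"
proof -
  assume F: "F 0 0 = 0" and a: "a \<in> D s" and b: "b \<in> D s"
  have "x \<in> Xs s" if "F (a x) (b x) \<noteq> 0" for x
  proof -
    have "a x \<noteq> 0 \<or> b x \<noteq> 0"
      using that F by metis
    then show ?thesis
      using D_nonzero[OF a] D_nonzero[OF b] by blast
  qed
  then show ?thesis
    using AR_space_combine[of a X b F] D_AR[OF a] D_AR[OF b] F by (intro DI) blast+
qed

lemma D_mono: "r \<preceq> s \<Longrightarrow> a \<in> D r \<Longrightarrow> a \<in> D s"
  using Xs_mono[of r s] by (auto simp: dualD_def)

lemma cutoff_AR: "openin X V \<Longrightarrow> closedin X V \<Longrightarrow> a \<in> AR_space X \<Longrightarrow> cutoff V a \<in> AR_space X"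
  unfolding cutoff_def by (rule AR_space_cut)

lemma cutoff_D: "openin X V \<Longrightarrow> closedin X V \<Longrightarrow> a \<in> D s \<Longrightarrow> cutoff V a \<in> D s"
proof -
  assume V: "openin X V" "closedin X V" and a: "a \<in> D s"
  show ?thesis
    using cutoff_AR[OF V D_AR[OF a]] D_nonzero[OF a] cutoff_nonzero[of V a] by (intro DI) blast+
qed

lemma L_D: "\<xi> \<in> L \<Longrightarrow> \<xi> s \<in> D s"
  by (simp add: cpL_def)

lemma L_finite: "\<xi> \<in> L \<Longrightarrow> finite {s. \<xi> s \<noteq> (\<lambda>_. 0)}"
  by (simp add: cpL_def)

lemma LI:
  assumes "finite F" "\<And>s. s \<notin> F \<Longrightarrow> \<xi> s = (\<lambda>_. 0)" "\<And>s. \<xi> s \<in> D s"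
  shows "\<xi> \<in> L"
proof -
  have "{s. \<xi> s \<noteq> (\<lambda>_. 0)} \<subseteq> F"
    using assms(2) by blast
  then show ?thesis
    unfolding cpL_def using finite_subset[OF _ assms(1)] assms(3) by blast
qed

lemma L_combine:
  assumes F: "F 0 0 = 0" and "\<xi> \<in> L" "\<eta> \<in> L"
  shows "(\<lambda>s x. F (\<xi> s x) (\<eta> s x)) \<in> L"
proof (rule LI)
  show "finite ({s. \<xi> s \<noteq> (\<lambda>_. 0)} \<union> {s. \<eta> s \<noteq> (\<lambda>_. 0)})"
    using L_finite[OF assms(2)] L_finite[OF assms(3)] by blast
  show "(\<lambda>x. F (\<xi> s x) (\<eta> s x)) \<in> D s" for s
    by (rule D_combine[of F, OF F L_D[OF assms(2)] L_D[OF assms(3)]])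
qed (simp add: F)

lemma L_zero: "(\<lambda>_ _. 0) \<in> L"
  by (rule LI[of "{}"]) (simp_all add: D_zero)

lemma single_L: "a \<in> D s \<Longrightarrow> single s a \<in> L"
  by (rule LI[of "{s}"]) (auto simp: single_apply D_zero)

lemma N_add: "\<xi> \<in> N \<Longrightarrow> \<eta> \<in> N \<Longrightarrow> (\<lambda>s x. \<xi> s x + \<eta> s x) \<in> N"
  using cpN.diff[OF _ cpN.diff[OF cpN.zero], of \<xi> mul D \<eta>] by simp

lemma N_gen: "r \<preceq> s \<Longrightarrow> a \<in> D r \<Longrightarrow> (\<lambda>t x. single r a t x - single s a t x) \<in> N"
  unfolding single_def by (rule cpN.gen)

lemma N_L: "\<xi> \<in> N \<Longrightarrow> \<xi> \<in> L"
proof (induction rule: cpN.induct)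
  case (gen r s a)
  then show ?case
    using L_combine[of "(-)", OF _ single_L[of a r] single_L[of a s]] D_mono[of r s a]
    by (simp add: single_def)
next
  case (diff \<xi> \<eta>)
  then show ?case using L_combine[of "(-)"] by simp
qed (rule L_zero)

text \<open>Cutting off a generator of \<open>N\<close> gives the generator with the coefficient cut
  off. This makes membership in \<open>N\<close> a question that can be studied locally.\<close>

lemma cutoff_N:
  assumes V: "openin X V" "closedin X V" and "\<xi> \<in> N"
  shows "(\<lambda>s. cutoff V (\<xi> s)) \<in> N"
  using assms(3)
proof (induction rule: cpN.induct)
  case zero
  then show ?case using cpN.zero by simp
next
  case (gen r s a)
  have "(\<lambda>t. cutoff V (\<lambda>x. (if t = r then a x else 0) - (if t = s then a x else 0)))
     = (\<lambda>t x. single r (cutoff V a) t x - single s (cutoff V a) t x)"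
    by (auto simp: cutoff_def single_def fun_eq_iff)
  then show ?case
    using N_gen[OF gen(1) cutoff_D[OF V gen(2)]] by simp
next
  case (diff \<xi> \<eta>)
  have "(\<lambda>t. cutoff V (\<lambda>x. \<xi> t x - \<eta> t x)) = (\<lambda>t x. cutoff V (\<xi> t) x - cutoff V (\<eta> t) x)"
    by (auto simp: cutoff_def fun_eq_iff)
  then show ?case
    using cpN.diff[OF diff.IH] by simp
qed

text \<open>Germs are equivalence classes of pairs, so \<open>(s, gsrc g) \<in> g\<close> says that \<open>g = [s, x]\<close> for some \<open>x\<close>.\<close>

definition gterm :: "'s \<Rightarrow> ('x \<Rightarrow> 'r::comm_ring_1) \<Rightarrow> ('s \<times> 'x) set \<Rightarrow> 'r" where
  "gterm s a g = (if g \<in> gs \<and> (s, gsrc g) \<in> g then a (grng th g) else 0)"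

definition Psi :: "('s \<Rightarrow> 'x \<Rightarrow> 'r::comm_ring_1) \<Rightarrow> ('s \<times> 'x) set \<Rightarrow> 'r" where
  "Psi \<xi> g = (\<Sum>s | \<xi> s \<noteq> (\<lambda>_. 0). gterm s (\<xi> s) g)"

lemma gterm_zero [simp]: "gterm s (\<lambda>_. 0) g = 0"
  by (simp add: gterm_def)

lemma gterm_germ: "x \<in> Xs (s\<^sup>\<star>) \<Longrightarrow> gterm s a (gm s x) = a (th s x)"
  by (simp add: gterm_def germ_in_gs germ_self)

lemma gterm_nonzero:
  assumes "gterm s a g \<noteq> 0"
  obtains x where "g = gm s x" "x \<in> Xs (s\<^sup>\<star>)" "a (th s x) \<noteq> 0"
proof -
  have g: "g \<in> gs" "(s, gsrc g) \<in> g"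
    using assms by (auto simp: gterm_def split: if_splits)
  then have "g = gm s (gsrc g)" "gsrc g \<in> Xs (s\<^sup>\<star>)"
    using mem_gs_iff by blast+
  then show thesis
    using that assms gterm_germ by metis
qed

text \<open>Enlarging the index set lets several formal sums be evaluated over one common
  set.\<close>

lemma Psi_eq_sum:
  assumes "finite F" "\<And>s. s \<notin> F \<Longrightarrow> \<xi> s = (\<lambda>_. 0)"
  shows "Psi \<xi> g = (\<Sum>s\<in>F. gterm s (\<xi> s) g)"
  unfolding Psi_def by (rule sum.mono_neutral_left) (use assms in auto)

lemma Psi_single: "Psi (single s a) g = gterm s a g"
  by (subst Psi_eq_sum[of "{s}"]) (simp_all add: single_apply)

lemma Psi_linear:
  assumes "\<xi> \<in> L" "\<eta> \<in> L"
  shows "Psi (\<lambda>s x. \<xi> s x + c * \<eta> s x) g = Psi \<xi> g + c * Psi \<eta> g"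
proof -
  let ?F = "{s. \<xi> s \<noteq> (\<lambda>_. 0)} \<union> {s. \<eta> s \<noteq> (\<lambda>_. 0)}"
  have fin: "finite ?F"
    using L_finite[OF assms(1)] L_finite[OF assms(2)] by blast
  have "Psi (\<lambda>s x. \<xi> s x + c * \<eta> s x) g = (\<Sum>s\<in>?F. gterm s (\<lambda>x. \<xi> s x + c * \<eta> s x) g)"
    by (rule Psi_eq_sum[OF fin]) auto
  also have "\<dots> = (\<Sum>s\<in>?F. gterm s (\<xi> s) g + c * gterm s (\<eta> s) g)"
    by (intro sum.cong refl) (simp add: gterm_def)
  also have "\<dots> = Psi \<xi> g + c * Psi \<eta> g"
    by (subst (1 2) Psi_eq_sum[OF fin]) (auto simp: sum.distrib sum_distrib_left)
  finally show ?thesis .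
qed

lemma Psi_add: "\<xi> \<in> L \<Longrightarrow> \<eta> \<in> L \<Longrightarrow> Psi (\<lambda>s x. \<xi> s x + \<eta> s x) g = Psi \<xi> g + Psi \<eta> g"
  using Psi_linear[of \<xi> \<eta> 1 g] by simp

lemma Psi_diff: "\<xi> \<in> L \<Longrightarrow> \<eta> \<in> L \<Longrightarrow> Psi (\<lambda>s x. \<xi> s x - \<eta> s x) g = Psi \<xi> g - Psi \<eta> g"
  using Psi_linear[of \<xi> \<eta> "-1" g] by simp

text \<open>Where \<open>r\<close> is defined, \<open>r\<close> and \<open>s\<close> have the same
  germs. Elsewhere both sides vanish: \<open>a\<close> is supported in \<open>Xs r\<close>, and
  injectivity of \<open>th s\<close> puts any source with range in \<open>Xs r\<close> into the
  domain of \<open>r\<close>.\<close>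

lemma gterm_le:
  assumes le: "r \<preceq> s" and a: "a \<in> D r"
  shows "gterm r a g = gterm s a g"
proof (cases "gterm s a g = 0")
  case True
  show ?thesis
  proof (rule ccontr)
    assume "gterm r a g \<noteq> gterm s a g"
    then have "gterm r a g \<noteq> 0" using True by simp
    then obtain x where x: "g = gm r x" "x \<in> Xs (r\<^sup>\<star>)" "a (th r x) \<noteq> 0"
      by (rule gterm_nonzero)
    then have "g = gm s x"
      using germ_eqI[OF le_refl le] by blast
    then have "gterm s a g = a (th s x)"
      using gterm_germ th_le(1)[OF le x(2)] by simp
    then show False
      using True x(3) th_le(2)[OF le x(2)] by simp
  qed
next
  case False
  then obtain x where x: "g = gm s x" "x \<in> Xs (s\<^sup>\<star>)" "a (th s x) \<noteq> 0"
    by (rule gterm_nonzero)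
  \<comment> \<open>The point that \<open>r\<close> sends to \<open>th s x\<close>; as
    \<open>s\<close> extends \<open>r\<close>, it has the same image as \<open>x\<close> under
    \<open>th s\<close> and so equals \<open>x\<close>.\<close>
  let ?z = "th (r\<^sup>\<star>) (th s x)"
  have y: "th s x \<in> Xs r"
    using D_nonzero[OF a x(3)] .
  then have z: "?z \<in> Xs (r\<^sup>\<star>)" "th r ?z = th s x"
    using th_star_in th_th_star by blast+
  then have "th s ?z = th s x" "?z \<in> Xs (s\<^sup>\<star>)"
    using th_le[OF le z(1)] by simp_all
  then have "?z = x"
    using th_star_th x(2) by metis
  then have "g = gm r x" "x \<in> Xs (r\<^sup>\<star>)"
    using germ_eqI[OF le_refl le] z(1) x(1) by auto
  then have "gterm r a g = a (th r x)"
    using gterm_germ by blast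
  then show ?thesis
    using z(2) \<open>?z = x\<close> gterm_germ[OF x(2), of a] x(1) by simp
qed

lemma Psi_N: "\<xi> \<in> N \<Longrightarrow> Psi \<xi> g = 0"
proof (induction rule: cpN.induct)
  case zero
  then show ?case by (simp add: Psi_def)
next
  case (gen r s a)
  then show ?case
    using Psi_diff[OF single_L[of a r] single_L[of a s], of g] D_mono[of r s a] gterm_le[of r s a g]
    by (simp add: Psi_single[unfolded single_def] single_def)
next
  case (diff \<xi> \<eta>)
  then show ?case using Psi_diff[OF N_L N_L, of \<xi> \<eta> g] by simp
qed

section \<open>The kernel of the evaluation map\<close>

text \<open>Induction on the number of coefficients that are nonzero at \<open>y\<close>: adding an
  element of \<open>N\<close> removes one index from the count.\<close>

lemma kernel_local:
  assumes "\<xi> \<in> L" "\<And>g. Psi \<xi> g = 0" "y \<in> topspace X"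
  shows "\<exists>W. openin X W \<and> closedin X W \<and> y \<in> W \<and> (\<lambda>s. cutoff W (\<xi> s)) \<in> N"
  using assms(1,2)
proof (induction "card {s. \<xi> s y \<noteq> 0}" arbitrary: \<xi> rule: less_induct)
  case less
  note \<xi> = less.prems(1)
  let ?F = "{s. \<xi> s \<noteq> (\<lambda>_. 0)}"
  have fin: "finite ?F"
    using L_finite[OF \<xi>] .
  show ?case
  proof (cases "\<exists>s. \<xi> s y \<noteq> 0")
    case False
    \<comment> \<open>Locally constant coefficients that vanish at \<open>y\<close> vanish near
      \<open>y\<close>, and only finitely many of them are not identically zero.\<close>
    have "\<exists>U. openin X U \<and> y \<in> U \<and> (\<forall>x\<in>U. \<xi> s x = 0)" for s
    proof -
      obtain U c where U: "openin X U" "y \<in> U" "\<And>x. x \<in> U \<Longrightarrow> \<xi> s x = c"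
        using AR_spaceE[OF D_AR[OF L_D[OF \<xi>]] assms(3)] by blast
      then have "c = 0"
        using False by metis
      then show ?thesis
        using U by blast
    qed
    then obtain U where U: "\<And>s. openin X (U s)" "\<And>s. y \<in> U s" "\<And>s x. x \<in> U s \<Longrightarrow> \<xi> s x = 0"
      by metis
    have "openin X ((\<Inter>s\<in>?F. U s) \<inter> topspace X)"
      using fin U(1) by (intro openin_INT) auto
    moreover have "y \<in> (\<Inter>s\<in>?F. U s) \<inter> topspace X"
      using U(2) assms(3) by blast
    ultimately obtain W where W: "openin X W" "closedin X W" "y \<in> W"
      and sub: "W \<subseteq> (\<Inter>s\<in>?F. U s) \<inter> topspace X"
      by (rule compact_open_nbhd)
    have "cutoff W (\<xi> s) x = 0" for s x
    proof (cases "\<xi> s = (\<lambda>_. 0)")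
      case False
      then show ?thesis
        using sub U(3)[of x s] by (auto simp: cutoff_def)
    qed simp
    then have "(\<lambda>s. cutoff W (\<xi> s)) = (\<lambda>_ _. 0)"
      by (intro ext)
    then show ?thesis
      using W cpN.zero by metis
  next
    case True
    then obtain s where s: "\<xi> s y \<noteq> 0" by blast
    then have y: "y \<in> Xs s"
      by (rule D_nonzero[OF L_D[OF \<xi>]])
    define x where "x = th (s\<^sup>\<star>) y"
    have x: "x \<in> Xs (s\<^sup>\<star>)" "th s x = y"
      using th_star_in th_th_star y by (auto simp: x_def)
    \<comment> \<open>The value of \<open>Psi \<xi>\<close> at \<open>gm s x\<close> is zero while
      the summand of \<open>s\<close> is not, so another summand is nonzero.\<close>
    have "\<exists>t\<in>?F - {s}. gterm t (\<xi> t) (gm s x) \<noteq> 0"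
    proof (rule ccontr)
      assume "\<not> ?thesis"
      then have "(\<Sum>t\<in>?F - {s}. gterm t (\<xi> t) (gm s x)) = 0"
        by simp
      moreover have "s \<in> ?F"
        using s by auto
      ultimately have "Psi \<xi> (gm s x) = gterm s (\<xi> s) (gm s x)"
        unfolding Psi_def using sum.remove[OF fin, of s "\<lambda>t. gterm t (\<xi> t) (gm s x)"] by simp
      then show False
        using less.prems(2) s gterm_germ[OF x(1), of "\<xi> s"] x(2) by simp
    qed
    then obtain t where t: "t \<noteq> s" "gterm t (\<xi> t) (gm s x) \<noteq> 0"
      by blast
    obtain x' where x': "gm s x = gm t x'" "x' \<in> Xs (t\<^sup>\<star>)" "\<xi> t (th t x') \<noteq> 0"
      using gterm_nonzero[OF t(2)] by blast
    have "x = x'"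
      using germ_eqD(1)[OF x'(1) x(1)] .
    obtain u where u: "u \<preceq> s" "u \<preceq> t" "x \<in> Xs (u\<^sup>\<star>)"
      using germ_eqD(2)[OF x'(1) x(1)] by blast
    have yt: "\<xi> t y \<noteq> 0"
      using x'(3) th_le(2)[OF u(1,3)] th_le(2)[OF u(2,3)] x(2) \<open>x = x'\<close> by simp
    have "y \<in> Xs u"
      using th_in[OF u(3)] th_le(2)[OF u(1,3)] x(2) by simp
    then obtain V where V: "openin X V" "closedin X V" "y \<in> V" "V \<subseteq> Xs u"
      by (rule compact_open_nbhd[OF open_Xs])
    \<comment> \<open>Cutting to \<open>V\<close>, a subset of \<open>Xs u\<close>, allows the
      coefficient to be attached to \<open>u\<close> as well.\<close>
    define a where "a = cutoff V (\<xi> s)"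
    have a: "a \<in> D u"
      unfolding a_def
    proof (rule DI)
      show "cutoff V (\<xi> s) \<in> AR_space X"
        by (rule cutoff_AR[OF V(1,2) D_AR[OF L_D[OF \<xi>]]])
      show "z \<in> Xs u" if "cutoff V (\<xi> s) z \<noteq> 0" for z
        using cutoff_nonzero[OF that] V(4) by blast
    qed
    \<comment> \<open>The terms at \<open>u\<close> cancel: \<open>n\<close> is
      \<open>a \<delta>\<^sub>t - a \<delta>\<^sub>s\<close>. The detour through \<open>u\<close> is
      needed because \<open>s\<close> and \<open>t\<close> need not be comparable.\<close>
    define n where "n = (\<lambda>r z. (single u a r z - single s a r z) - (single u a r z - single t a r z))"
    have n: "n \<in> N"
      unfolding n_def using cpN.diff[OF N_gen[OF u(1) a] N_gen[OF u(2) a]] .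
    define \<xi>' where "\<xi>' = (\<lambda>r z. \<xi> r z + n r z)"
    have "\<xi>' \<in> L"
      unfolding \<xi>'_def using L_combine[of "(+)", OF _ \<xi> N_L[OF n]] by simp
    moreover have "Psi \<xi>' g = 0" for g
      unfolding \<xi>'_def using Psi_add[OF \<xi> N_L[OF n]] Psi_N[OF n] less.prems(2) by simp
    moreover have "card {r. \<xi>' r y \<noteq> 0} < card {r. \<xi> r y \<noteq> 0}"
    proof (rule psubset_card_mono)
      show "finite {r. \<xi> r y \<noteq> 0}"
        by (rule finite_subset[OF _ fin]) auto
      have "\<xi>' s y = 0" "\<And>r. r \<noteq> s \<Longrightarrow> r \<noteq> t \<Longrightarrow> \<xi>' r y = \<xi> r y"
        using t(1) V(3) by (auto simp: \<xi>'_def n_def single_def a_def cutoff_def)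
      then have "r \<noteq> s \<and> \<xi> r y \<noteq> 0" if "\<xi>' r y \<noteq> 0" for r
        using that yt by metis
      then show "{r. \<xi>' r y \<noteq> 0} \<subset> {r. \<xi> r y \<noteq> 0}"
        using s by blast
    qed
    ultimately obtain W where W: "openin X W" "closedin X W" "y \<in> W" "(\<lambda>s. cutoff W (\<xi>' s)) \<in> N"
      using less.hyps[of \<xi>'] by blast
    have "(\<lambda>s. cutoff W (\<xi> s)) = (\<lambda>s z. cutoff W (\<xi>' s) z - cutoff W (n s) z)"
      by (auto simp: cutoff_def \<xi>'_def fun_eq_iff)
    then have "(\<lambda>s. cutoff W (\<xi> s)) \<in> N"
      using cpN.diff[OF W(4) cutoff_N[OF W(1,2) n]] by simp
    then show ?thesis
      using W by blast
  qed
qed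

lemma L_support_compact:
  assumes "\<xi> \<in> L"
  shows "\<exists>K. compactin X K \<and> (\<forall>s x. \<xi> s x \<noteq> 0 \<longrightarrow> x \<in> K)"
proof -
  let ?F = "{s. \<xi> s \<noteq> (\<lambda>_. 0)}"
  obtain K where K: "\<And>s. compactin X (K s)" "\<And>s. {x. \<xi> s x \<noteq> 0} \<subseteq> K s"
    using AR_spaceD(2)[OF D_AR[OF L_D[OF assms]]] by metis
  have "compactin X (\<Union>(K ` ?F))"
    by (rule compactin_Union) (use L_finite[OF assms] K(1) in auto)
  moreover have "x \<in> \<Union>(K ` ?F)" if "\<xi> s x \<noteq> 0" for s x
  proof (rule UnionI)
    show "K s \<in> K ` ?F"
      using that by (intro imageI CollectI) auto
    show "x \<in> K s"
      using that K(2)[of s] by blast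
  qed
  ultimately show ?thesis by blast
qed

text \<open>The local result spreads over a compact set containing the supports of all coefficients,
  and cutting off to a clopen superset of that set changes nothing.\<close>

lemma kernel:
  assumes \<xi>: "\<xi> \<in> L" "\<And>g. Psi \<xi> g = 0"
  shows "\<xi> \<in> N"
proof -
  obtain K where K: "compactin X K" "\<And>s x. \<xi> s x \<noteq> 0 \<Longrightarrow> x \<in> K"
    using L_support_compact[OF \<xi>(1)] by blast
  have "\<exists>W. openin X W \<and> closedin X W \<and> K \<subseteq> W \<and> (\<lambda>s. cutoff W (\<xi> s)) \<in> N"
    using K(1)
  proof (induction rule: compact_clopen_cover_induct)
    case empty
    then show ?case using cpN.zero by (simp add: cutoff_def)
  next
    case (union V W)
    have "(\<lambda>s. cutoff (V \<union> W) (\<xi> s)) = (\<lambda>s x. cutoff V (\<xi> s) x + cutoff W (\<xi> s) x)"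
      using union(5) by (auto simp: cutoff_def fun_eq_iff)
    then show ?case
      using N_add union by simp
  next
    case (local y)
    then have "y \<in> topspace X"
      using compactin_subset_topspace[OF K(1)] by blast
    then obtain W where W: "openin X W" "closedin X W" "y \<in> W" "(\<lambda>s. cutoff W (\<xi> s)) \<in> N"
      using kernel_local[OF \<xi>] by blast
    have "(\<lambda>s. cutoff V (\<xi> s)) \<in> N" if V: "openin X V" "closedin X V" "V \<subseteq> W" for V
    proof -
      have "(\<lambda>s. cutoff V (\<xi> s)) = (\<lambda>s. cutoff V (cutoff W (\<xi> s)))"
        using V(3) by (auto simp: cutoff_def fun_eq_iff)
      then show ?thesis
        using cutoff_N[OF V(1,2) W(4)] by simp
    qed
    then show ?case using W by blast
  qed
  then obtain W where W: "K \<subseteq> W" "(\<lambda>s. cutoff W (\<xi> s)) \<in> N" by blast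
  have "cutoff W (\<xi> s) x = \<xi> s x" for s x
    using K(2) W(1) by (auto simp: cutoff_def)
  then have "(\<lambda>s. cutoff W (\<xi> s)) = \<xi>" by (intro ext)
  then show ?thesis using W(2) by simp
qed

section \<open>The image of the evaluation map\<close>

lemma A_sum:
  assumes "finite I" "\<And>i. i \<in> I \<Longrightarrow> f i \<in> A"
  shows "(\<lambda>g. \<Sum>i\<in>I. f i g) \<in> A"
  using assms
proof (induction I)
  case empty
  then show ?case using steinberg.zero by simp
next
  case (insert i I)
  then show ?case
    using steinberg.add[of "f i" mul X Xs th "\<lambda>g. \<Sum>i\<in>I. f i g"] by simp
qed

text \<open>The bridge between coefficients and generators of the Steinberg algebra: a constant on
  \<open>V\<close> evaluates to a multiple of the characteristic function of
  \<open>bis s V\<close>.\<close>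

lemma gterm_indicator:
  "gterm s (\<lambda>x. if x \<in> V then c else 0) = (\<lambda>g. if g \<in> bis s V then c else 0)"
proof
  fix g
  show "gterm s (\<lambda>x. if x \<in> V then c else 0) g = (if g \<in> bis s V then c else 0)"
  proof (cases "g \<in> bis s V")
    case True
    then obtain x where "g = gm s x" "x \<in> Xs (s\<^sup>\<star>)" "th s x \<in> V"
      by (auto simp: bis_def)
    then show ?thesis
      using True by (simp add: gterm_germ)
  next
    case False
    have "gterm s (\<lambda>x. if x \<in> V then c else 0) g = 0"
    proof (rule ccontr)
      assume "gterm s (\<lambda>x. if x \<in> V then c else 0) g \<noteq> 0"
      then obtain x where "g = gm s x" "x \<in> Xs (s\<^sup>\<star>)" "(if th s x \<in> V then c else 0) \<noteq> 0"
        by (rule gterm_nonzero)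
      then have "g \<in> bis s V"
        unfolding bis_def by (auto split: if_splits)
      then show False using False by blast
    qed
    then show ?thesis using False by simp
  qed
qed

text \<open>Around each point of a compact set containing the support, \<open>a\<close> is constant,
  so a small cutoff of it evaluates to zero or to a multiple of a bisection's characteristic
  function; disjoint unions become sums.\<close>

lemma gterm_A:
  assumes a: "a \<in> D s"
  shows "gterm s a \<in> A"
proof -
  obtain K where K: "compactin X K" "{x. a x \<noteq> 0} \<subseteq> K"
    using AR_spaceD(2)[OF D_AR[OF a]] by blast
  have "\<exists>W. openin X W \<and> closedin X W \<and> K \<subseteq> W \<and> gterm s (cutoff W a) \<in> A"
    using K(1)
  proof (induction rule: compact_clopen_cover_induct)
    case empty
    have "gterm s (cutoff {} a) = (\<lambda>_. 0)"
      by (simp add: gterm_def cutoff_def fun_eq_iff)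
    then show ?case using steinberg.zero by simp
  next
    case (union V W)
    have "gterm s (cutoff (V \<union> W) a) = (\<lambda>g. gterm s (cutoff V a) g + gterm s (cutoff W a) g)"
      using union(5) by (auto simp: gterm_def cutoff_def fun_eq_iff)
    then show ?case
      using steinberg.add[OF union(6,7)] by simp
  next
    case (local y)
    then have "y \<in> topspace X"
      using compactin_subset_topspace[OF K(1)] by blast
    then obtain U c where U: "openin X U" "y \<in> U" "\<And>x. x \<in> U \<Longrightarrow> a x = c"
      using AR_spaceE[OF D_AR[OF a]] by blast
    obtain W where W: "openin X W" "closedin X W" "compactin X W" "y \<in> W" "W \<subseteq> U"
      using compact_open_nbhd[OF U(1,2)] by blast
    have "gterm s (cutoff V a) \<in> A" if V: "openin X V" "closedin X V" "V \<subseteq> W" for V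
    proof -
      have cutoff: "cutoff V a = (\<lambda>x. if x \<in> V then c else 0)"
        using U(3) V(3) W(5) by (auto simp: cutoff_def fun_eq_iff)
      show ?thesis
      \<comment> \<open>If \<open>c = 0\<close>, the set \<open>V\<close> may leave
        \<open>Xs s\<close> and give no compact bisection, but the function is then zero
        anyway.\<close>
      proof (cases "c = 0")
        case True
        then have "gterm s (cutoff V a) = (\<lambda>_. 0)"
          unfolding cutoff by (auto simp: fun_eq_iff gterm_def)
        then show ?thesis using steinberg.zero by simp
      next
        case False
        have "x \<in> Xs s" if "x \<in> V" for x
        proof (rule D_nonzero[OF a])
          have "x \<in> U" using that V(3) W(5) by blast
          then show "a x \<noteq> 0" using U(3) False by simp
        qed
        then have "V \<subseteq> Xs s" by blast
        moreover have "compactin X V"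
          by (rule closed_compactin[OF W(3) V(3,2)])
        ultimately show ?thesis
          unfolding cutoff gterm_indicator by (intro steinberg.gen compact_open_bis V(1))
      qed
    qed
    then show ?case using W by blast
  qed
  then obtain W where W: "K \<subseteq> W" "gterm s (cutoff W a) \<in> A" by blast
  have "cutoff W a x = a x" for x
    using K(2) W(1) by (auto simp: cutoff_def)
  then have "cutoff W a = a" by (intro ext)
  then show ?thesis using W(2) by simp
qed

lemma Psi_A: "\<xi> \<in> L \<Longrightarrow> Psi \<xi> \<in> A"
  unfolding Psi_def using A_sum[OF L_finite gterm_A[OF L_D]] by simp

text \<open>The bisection is cut into pieces by range. Around the range of a germ in
  \<open>B\<close>, a basic set \<open>[s, U]\<close> inside \<open>B\<close> supplies the index
  \<open>s\<close>, and the piece over a small clopen \<open>V\<close> is exactly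
  \<open>bis s V\<close>.\<close>

lemma bisection_in_image:
  assumes B: "compact_open_bisection mul X Xs th B"
  shows "\<exists>\<xi>\<in>L. Psi \<xi> = (\<lambda>g. if g \<in> B then c else 0)"
proof -
  let ?r = "grng th"
  have sub: "B \<subseteq> gs" and op: "openin gtop B" and comp: "compactin gtop B" and inj: "inj_on ?r B"
    using B by (simp_all add: compact_open_bisection_def)
  let ?P = "\<lambda>W. \<exists>\<xi>\<in>L. Psi \<xi> = (\<lambda>g. if g \<in> B \<and> ?r g \<in> W then c else 0)"
  have K: "compactin X (?r ` B)"
    using image_compactin[OF comp continuous_grng] .
  have "\<exists>W. openin X W \<and> closedin X W \<and> ?r ` B \<subseteq> W \<and> ?P W"
    using K
  proof (induction rule: compact_clopen_cover_induct)
    case empty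
    have "Psi (\<lambda>_ _. 0) = (\<lambda>_. 0)"
      by (simp add: Psi_def fun_eq_iff)
    then show ?case using L_zero by (intro bexI[of _ "\<lambda>_ _. 0"]) simp_all
  next
    case (union V W)
    then obtain \<xi> \<eta> where \<xi>: "\<xi> \<in> L" "Psi \<xi> = (\<lambda>g. if g \<in> B \<and> ?r g \<in> V then c else 0)"
      and \<eta>: "\<eta> \<in> L" "Psi \<eta> = (\<lambda>g. if g \<in> B \<and> ?r g \<in> W then c else 0)"
      by blast
    have "Psi (\<lambda>s x. \<xi> s x + \<eta> s x) = (\<lambda>g. if g \<in> B \<and> ?r g \<in> V \<union> W then c else 0)"
      using Psi_add[OF \<xi>(1) \<eta>(1)] union(5) by (auto simp: \<xi>(2) \<eta>(2) fun_eq_iff)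
    moreover have "(\<lambda>s x. \<xi> s x + \<eta> s x) \<in> L"
      using L_combine[of "(+)", OF _ \<xi>(1) \<eta>(1)] by simp
    ultimately show ?case by blast
  next
    case (local y)
    then obtain g where g: "g \<in> B" "y = ?r g" by blast
    obtain s U where U: "openin X U" "U \<subseteq> Xs (s\<^sup>\<star>)" "g \<in> {gm s x | x. x \<in> U}" "{gm s x | x. x \<in> U} \<subseteq> B"
      using gtop_basis[OF op g(1)] by (elim exE conjE)
    then obtain x where x: "g = gm s x" "x \<in> U" by blast
    then have xs: "x \<in> Xs (s\<^sup>\<star>)" using U(2) by blast
    have "y \<in> {z \<in> Xs s. th (s\<^sup>\<star>) z \<in> U}"
      using g(2) x xs th_in th_star_th by simp
    then obtain W where W: "openin X W" "closedin X W" "compactin X W" "y \<in> W"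
      and WU: "W \<subseteq> {z \<in> Xs s. th (s\<^sup>\<star>) z \<in> U}"
      by (rule compact_open_nbhd[OF open_th_star_preimage[OF U(1)]])
    have "?P V" if V: "openin X V" "closedin X V" "V \<subseteq> W" for V
    proof -
      let ?a = "\<lambda>x. if x \<in> V then c else 0"
      have "compactin X V"
        by (rule closed_compactin[OF W(3) V(3,2)])
      then have "?a \<in> D s"
        using AR_space_indicator[OF V(1,2)] V(3) WU by (intro DI) (auto split: if_splits)
      moreover have "h \<in> bis s V \<longleftrightarrow> h \<in> B \<and> ?r h \<in> V" for h
      proof
        assume "h \<in> bis s V"
        then obtain z where z: "h = gm s z" "z \<in> Xs (s\<^sup>\<star>)" "th s z \<in> V"
          by (auto simp: bis_def)
        then have "z \<in> U"
          using V(3) WU th_star_th[of z s] by force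
        then show "h \<in> B \<and> ?r h \<in> V"
          using z U(4) by auto
      next
        assume h: "h \<in> B \<and> ?r h \<in> V"
        let ?z = "th (s\<^sup>\<star>) (?r h)"
        have z: "?r h \<in> Xs s" "?z \<in> U"
          using h V(3) WU by blast+
        then have z': "?z \<in> Xs (s\<^sup>\<star>)" "th s ?z = ?r h"
          using th_star_in th_th_star by blast+
        have "gm s ?z \<in> B"
          using U(4) z(2) by blast
        moreover have "?r (gm s ?z) = ?r h"
          using z' by simp
        \<comment> \<open>Both germs lie in \<open>B\<close> and have the same range, on which
          \<open>B\<close> is injective.\<close>
        ultimately have "gm s ?z = h"
          using inj h by (simp add: inj_on_eq_iff)
        then show "h \<in> bis s V"
          unfolding bis_def using z' h by (intro CollectI exI[of _ ?z]) simp
      qed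
      ultimately show ?thesis
        using single_L[of ?a s] by (intro bexI[of _ "single s ?a"]) (simp_all add: fun_eq_iff Psi_single gterm_indicator)
    qed
    then show ?case
      using W by blast
  qed
  then obtain W \<xi> where W: "?r ` B \<subseteq> W" and \<xi>: "\<xi> \<in> L" "Psi \<xi> = (\<lambda>g. if g \<in> B \<and> ?r g \<in> W then c else 0)"
    by blast
  have "(g \<in> B \<and> ?r g \<in> W) = (g \<in> B)" for g
    using W by blast
  then show ?thesis
    using \<xi> by (intro bexI[of _ \<xi>]) simp_all
qed

lemma Psi_surj: "f \<in> A \<Longrightarrow> \<exists>\<xi>\<in>L. Psi \<xi> = f"
proof (induction rule: steinberg.induct)
  case zero
  have "Psi (\<lambda>_ _. 0) = (\<lambda>_. 0)"
    by (simp add: Psi_def fun_eq_iff)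
  then show ?case using L_zero by (intro bexI[of _ "\<lambda>_ _. 0"]) simp_all
next
  case (gen B c)
  then show ?case by (rule bisection_in_image)
next
  case (add f h)
  then obtain \<xi> \<eta> where \<xi>: "\<xi> \<in> L" "Psi \<xi> = f" and \<eta>: "\<eta> \<in> L" "Psi \<eta> = h"
    by blast
  have "Psi (\<lambda>s x. \<xi> s x + \<eta> s x) = (\<lambda>g. f g + h g)"
    using Psi_add[OF \<xi>(1) \<eta>(1)] by (simp add: \<xi>(2) \<eta>(2) fun_eq_iff)
  moreover have "(\<lambda>s x. \<xi> s x + \<eta> s x) \<in> L"
    using L_combine[of "(+)", OF _ \<xi>(1) \<eta>(1)] by simp
  ultimately show ?case by blast
qed

section \<open>Multiplicativity\<close>

text \<open>The coefficient \<open>\<alpha>\<^sub>s(\<alpha>\<^sub>s\<^sub>\<star>(a) b)\<close> of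
  the crossed product in closed form. Outside \<open>Xs s\<close> the value of
  \<open>th (s\<^sup>\<star>)\<close> is uncontrolled, which is harmless because there
  \<open>a\<close> vanishes when it belongs to \<open>D s\<close>.\<close>

definition mterm :: "'s \<Rightarrow> ('x \<Rightarrow> 'r::comm_ring_1) \<Rightarrow> ('x \<Rightarrow> 'r) \<Rightarrow> 'x \<Rightarrow> 'r" where
  "mterm s a b = (\<lambda>x. a x * b (th (s\<^sup>\<star>) x))"

lemma dual_alpha_mult:
  assumes a: "a \<in> D s"
  shows "dual_alpha mul Xs th s (\<lambda>y. dual_alpha mul Xs th (s\<^sup>\<star>) a y * b y) = mterm s a b"
proof
  fix x
  show "dual_alpha mul Xs th s (\<lambda>y. dual_alpha mul Xs th (s\<^sup>\<star>) a y * b y) x = mterm s a b x"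
  proof (cases "x \<in> Xs s")
    case True
    then show ?thesis
      using th_star_in[OF True] th_th_star[OF True] by (simp add: dual_alpha_def mterm_def)
  next
    case False
    then have "a x = 0" using D_nonzero[OF a] by blast
    then show ?thesis
      using False by (simp add: dual_alpha_def mterm_def)
  qed
qed

text \<open>A point where the product is nonzero can be pulled back first along \<open>s\<close> and
  then along \<open>t\<close>, which shows it to be the range of a composable pair.\<close>

lemma mterm_nonzero:
  assumes a: "a \<in> D s" and b: "b \<in> D t" and "mterm s a b z \<noteq> 0"
  obtains x where "x \<in> Xs (t\<^sup>\<star>)" "th t x \<in> Xs (s\<^sup>\<star>)" "z = th (s \<cdot> t) x" "x \<in> Xs ((s \<cdot> t)\<^sup>\<star>)"
proof -
  have "a z \<noteq> 0" "b (th (s\<^sup>\<star>) z) \<noteq> 0"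
    using assms(3) by (auto simp: mterm_def)
  then have z: "z \<in> Xs s" "th (s\<^sup>\<star>) z \<in> Xs t"
    using D_nonzero[OF a] D_nonzero[OF b] by blast+
  let ?x = "th (t\<^sup>\<star>) (th (s\<^sup>\<star>) z)"
  have x: "?x \<in> Xs (t\<^sup>\<star>)" "th t ?x = th (s\<^sup>\<star>) z" "th (s\<^sup>\<star>) z \<in> Xs (s\<^sup>\<star>)" "th s (th (s\<^sup>\<star>) z) = z"
    using th_star_in th_th_star z by blast+
  show thesis
    using that[of ?x] th_comp[of ?x t s] x by simp
qed

lemma mterm_D:
  assumes a: "a \<in> D s" and b: "b \<in> D t"
  shows "mterm s a b \<in> D (s \<cdot> t)"
proof (rule DI)
  obtain K where K: "compactin X K" "{x. a x \<noteq> 0} \<subseteq> K"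
    using AR_spaceD(2)[OF D_AR[OF a]] by blast
  show "mterm s a b \<in> AR_space X"
  proof (rule AR_spaceI[OF _ _ K(1)])
    fix x assume "mterm s a b x \<noteq> 0"
    then have "a x \<noteq> 0" by (auto simp: mterm_def)
    then show "x \<in> K" "x \<in> topspace X"
      using K(2) AR_spaceD(1)[OF D_AR[OF a]] by blast+
  next
    fix x assume x: "x \<in> topspace X"
    obtain U c where U: "openin X U" "x \<in> U" "\<And>y. y \<in> U \<Longrightarrow> a y = c"
      using AR_spaceE[OF D_AR[OF a] x] by blast
    show "\<exists>U d. openin X U \<and> x \<in> U \<and> (\<forall>y\<in>U. mterm s a b y = d)"
    \<comment> \<open>If \<open>a\<close> vanishes near \<open>x\<close>, so does the product,
      whatever \<open>b\<close> does. Otherwise \<open>x\<close> lies in \<open>Xs s\<close>, where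
      \<open>th (s\<^sup>\<star>)\<close> is continuous.\<close>
    proof (cases "c = 0")
      case True
      then show ?thesis
        using U by (intro exI[of _ U] exI[of _ 0]) (simp add: mterm_def)
    next
      case False
      then have xs: "x \<in> Xs s"
        using D_nonzero[OF a] U by blast
      obtain V d where V: "openin X V" "th (s\<^sup>\<star>) x \<in> V" "\<And>y. y \<in> V \<Longrightarrow> b y = d"
        using AR_spaceE[OF D_AR[OF b] Xs_topspace[OF th_star_in[OF xs]]] by blast
      have "openin X (U \<inter> {z \<in> Xs s. th (s\<^sup>\<star>) z \<in> V})"
        using U(1) open_th_star_preimage[OF V(1)] by blast
      then show ?thesis
        using U V xs by (intro exI[of _ "U \<inter> {z \<in> Xs s. th (s\<^sup>\<star>) z \<in> V}"] exI[of _ "c * d"])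
          (simp add: mterm_def)
    qed
  qed
  show "x \<in> Xs (s \<cdot> t)" if "mterm s a b x \<noteq> 0" for x
    using mterm_nonzero[OF a b that] th_in by metis
qed

lemma D_sum:
  assumes "finite I" "\<And>i. i \<in> I \<Longrightarrow> f i \<in> D s"
  shows "(\<lambda>x. \<Sum>i\<in>I. f i x) \<in> D s"
  using assms
proof (induction I)
  case empty
  then show ?case using D_zero by simp
next
  case (insert i I)
  then show ?case
    using D_combine[of "(+)" "f i" s "\<lambda>x. \<Sum>i\<in>I. f i x"] by simp
qed

lemma gterm_sum: "gterm u (\<lambda>x. \<Sum>i\<in>I. f i x) g = (\<Sum>i\<in>I. gterm u (f i) g)"
  by (cases "g \<in> gs"; cases "(u, gsrc g) \<in> g") (simp_all add: gterm_def)

abbreviation supp :: "('s \<Rightarrow> 'x \<Rightarrow> 'r::zero) \<Rightarrow> 's set" where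
  "supp \<xi> \<equiv> {s. \<xi> s \<noteq> (\<lambda>_. 0)}"

text \<open>Writing the index set as a fibre of the multiplication map prepares the regrouping of
  the sum over all pairs.\<close>

lemma cpL_mul_eq:
  assumes "\<xi> \<in> L"
  shows "cpL_mul mul (dual_alpha mul Xs th) \<xi> \<eta> u =
    (\<lambda>x. \<Sum>p\<in>{p \<in> supp \<xi> \<times> supp \<eta>. (\<lambda>(s, t). s \<cdot> t) p = u}.
       (case p of (s, t) \<Rightarrow> mterm s (\<xi> s) (\<eta> t)) x)"
proof -
  have "{(s, t). \<xi> s \<noteq> (\<lambda>_. 0) \<and> \<eta> t \<noteq> (\<lambda>_. 0) \<and> s \<cdot> t = u} =
    {p \<in> supp \<xi> \<times> supp \<eta>. (\<lambda>(s, t). s \<cdot> t) p = u}"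
    by auto
  then show ?thesis
    unfolding cpL_mul_def by (simp add: dual_alpha_mult[OF L_D[OF assms]] case_prod_unfold)
qed

lemma cpL_mul_L:
  assumes "\<xi> \<in> L" "\<eta> \<in> L"
  shows "cpL_mul mul (dual_alpha mul Xs th) \<xi> \<eta> \<in> L"
proof (rule LI)
  have fin: "finite (supp \<xi> \<times> supp \<eta>)"
    using assms L_finite by (intro finite_cartesian_product)
  then show "finite ((\<lambda>(s, t). s \<cdot> t) ` (supp \<xi> \<times> supp \<eta>))"
    by (rule finite_imageI)
  fix u
  show "cpL_mul mul (dual_alpha mul Xs th) \<xi> \<eta> u \<in> D u"
    unfolding cpL_mul_eq[OF assms(1)]
  proof (rule D_sum)
    show "finite {p \<in> supp \<xi> \<times> supp \<eta>. (\<lambda>(s, t). s \<cdot> t) p = u}"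
      by (rule finite_subset[OF _ fin]) blast
    fix p assume "p \<in> {p \<in> supp \<xi> \<times> supp \<eta>. (\<lambda>(s, t). s \<cdot> t) p = u}"
    then show "(case p of (s, t) \<Rightarrow> mterm s (\<xi> s) (\<eta> t)) \<in> D u"
      using mterm_D[OF L_D[OF assms(1)] L_D[OF assms(2)]] by (auto split: prod.split)
  qed
next
  fix u assume "u \<notin> (\<lambda>(s, t). s \<cdot> t) ` (supp \<xi> \<times> supp \<eta>)"
  then have "{p \<in> supp \<xi> \<times> supp \<eta>. (\<lambda>(s, t). s \<cdot> t) p = u} = {}"
    by blast
  then show "cpL_mul mul (dual_alpha mul Xs th) \<xi> \<eta> u = (\<lambda>_. 0)"
    unfolding cpL_mul_eq[OF assms(1)] by (simp only: sum.empty)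
qed

lemma Psi_mul:
  assumes "\<xi> \<in> L" "\<eta> \<in> L"
  shows "Psi (cpL_mul mul (dual_alpha mul Xs th) \<xi> \<eta>) g =
    (\<Sum>(s, t)\<in>supp \<xi> \<times> supp \<eta>. gterm (s \<cdot> t) (mterm s (\<xi> s) (\<eta> t)) g)"
proof -
  let ?m = "\<lambda>(s, t). s \<cdot> t"
  let ?I = "supp \<xi> \<times> supp \<eta>"
  let ?h = "\<lambda>p. case p of (s, t) \<Rightarrow> gterm (s \<cdot> t) (mterm s (\<xi> s) (\<eta> t)) g"
  have fin: "finite ?I"
    using assms L_finite by (intro finite_cartesian_product)
  have "Psi (cpL_mul mul (dual_alpha mul Xs th) \<xi> \<eta>) g =
    (\<Sum>u\<in>?m ` ?I. gterm u (cpL_mul mul (dual_alpha mul Xs th) \<xi> \<eta> u) g)"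
  proof (rule Psi_eq_sum)
    fix u assume "u \<notin> ?m ` ?I"
    then have "{p \<in> ?I. ?m p = u} = {}"
      by blast
    then show "cpL_mul mul (dual_alpha mul Xs th) \<xi> \<eta> u = (\<lambda>_. 0)"
      unfolding cpL_mul_eq[OF assms(1)] by (simp only: sum.empty)
  qed (use fin in blast)
  also have "\<dots> = (\<Sum>u\<in>?m ` ?I. \<Sum>p\<in>{p \<in> ?I. ?m p = u}. ?h p)"
    unfolding cpL_mul_eq[OF assms(1)] gterm_sum by (intro sum.cong refl) (auto split: prod.split)
  also have "\<dots> = sum ?h ?I"
    by (rule sum.group) (use fin in auto)
  finally show ?thesis .
qed

section \<open>Factorizations of a germ and convolution\<close>

abbreviation factorizations :: "('s \<times> 'x) set \<Rightarrow> (('s \<times> 'x) set \<times> ('s \<times> 'x) set) set" where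
  "factorizations g \<equiv> {(b, c). b \<in> gs \<and> c \<in> gs \<and> gsrc b = grng th c \<and> gmul mul Xs b c = g}"

text \<open>Nonzero terms force \<open>b\<close> and \<open>c\<close> to be germs of
  \<open>s\<close> and \<open>t\<close>, and the source of \<open>c\<close> is that of
  \<open>g\<close>. Hence \<open>s\<close>, \<open>t\<close> and \<open>g\<close> determine the
  factorization.\<close>

lemma factorization_gterm:
  assumes "(b, c) \<in> factorizations g" "gterm s \<alpha> b \<noteq> 0" "gterm t \<beta> c \<noteq> 0"
  shows "b = gm s (th t (gsrc g))" "c = gm t (gsrc g)"
    "gterm s \<alpha> b * gterm t \<beta> c = gterm (s \<cdot> t) (mterm s \<alpha> \<beta>) g"
proof -
  obtain x where x: "c = gm t x" "x \<in> Xs (t\<^sup>\<star>)"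
    using gterm_nonzero[OF assms(3)] by blast
  obtain y where y: "b = gm s y" "y \<in> Xs (s\<^sup>\<star>)"
    using gterm_nonzero[OF assms(2)] by blast
  have bc: "gsrc b = grng th c" "gmul mul Xs b c = g"
    using assms(1) by auto
  have yx: "y = th t x"
    using bc(1) x y by simp
  have g: "g = gm (s \<cdot> t) x"
    using bc(2) gmul_germ[of x t s] x y yx by simp
  have st: "x \<in> Xs ((s \<cdot> t)\<^sup>\<star>)" "th (s \<cdot> t) x = th s (th t x)"
    using th_comp[of x t s] x y yx by simp_all
  have "gsrc g = x"
    using g st by simp
  then show "b = gm s (th t (gsrc g))" "c = gm t (gsrc g)"
    using x y yx by simp_all
  show "gterm s \<alpha> b * gterm t \<beta> c = gterm (s \<cdot> t) (mterm s \<alpha> \<beta>) g"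
    using x(2) y(2) st by (simp add: g x(1) y(1) yx gterm_germ mterm_def th_star_th)
qed

text \<open>A nonzero product term yields a composable pair over some \<open>x'\<close> with the
  same range as \<open>g\<close>; injectivity of \<open>th (s \<cdot> t)\<close> identifies
  \<open>x'\<close> with the source of \<open>g\<close>.\<close>

lemma factorization_exists:
  assumes \<alpha>: "\<alpha> \<in> D s" and \<beta>: "\<beta> \<in> D t" and nz: "gterm (s \<cdot> t) (mterm s \<alpha> \<beta>) g \<noteq> 0"
  shows "(gm s (th t (gsrc g)), gm t (gsrc g)) \<in> factorizations g"
    and "gterm s \<alpha> (gm s (th t (gsrc g))) * gterm t \<beta> (gm t (gsrc g)) = gterm (s \<cdot> t) (mterm s \<alpha> \<beta>) g"
proof -
  obtain x where x: "g = gm (s \<cdot> t) x" "x \<in> Xs ((s \<cdot> t)\<^sup>\<star>)" "mterm s \<alpha> \<beta> (th (s \<cdot> t) x) \<noteq> 0"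
    using gterm_nonzero[OF nz] by blast
  obtain x' where x': "x' \<in> Xs (t\<^sup>\<star>)" "th t x' \<in> Xs (s\<^sup>\<star>)" "th (s \<cdot> t) x = th (s \<cdot> t) x'"
    "x' \<in> Xs ((s \<cdot> t)\<^sup>\<star>)"
    using mterm_nonzero[OF \<alpha> \<beta> x(3)] by blast
  have xx': "x' = x"
    using x'(3) th_star_th[OF x'(4)] th_star_th[OF x(2)] by simp
  have gx: "gsrc g = x"
    using x(1,2) by simp
  show "(gm s (th t (gsrc g)), gm t (gsrc g)) \<in> factorizations g"
    unfolding gx using x' gmul_germ[of x t s] germ_in_gs by (simp add: x(1) xx')
  show "gterm s \<alpha> (gm s (th t (gsrc g))) * gterm t \<beta> (gm t (gsrc g)) = gterm (s \<cdot> t) (mterm s \<alpha> \<beta>) g"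
    unfolding gx using x' x(2) th_comp(2)[of x t s] by (simp add: x(1) xx' gterm_germ mterm_def th_star_th)
qed

text \<open>The convolution is summed over the finite set \<open>?P\<close> of candidate
  factorizations, which allows expanding both factors and exchanging sums. For each pair
  \<open>(s, t)\<close> at most one factorization then contributes. Different pairs may share a
  factorization, which does no harm since the outer sum runs over pairs.\<close>

lemma conv_Psi:
  assumes \<xi>: "\<xi> \<in> L" and \<eta>: "\<eta> \<in> L"
  shows "conv mul Xs th (Psi \<xi>) (Psi \<eta>) g =
    (\<Sum>(s, t)\<in>supp \<xi> \<times> supp \<eta>. gterm (s \<cdot> t) (mterm s (\<xi> s) (\<eta> t)) g)"
proof -
  let ?I = "supp \<xi> \<times> supp \<eta>"
  let ?p = "\<lambda>(s, t). (gm s (th t (gsrc g)), gm t (gsrc g))"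
  let ?P = "factorizations g \<inter> ?p ` ?I"
  let ?C = "{(b, c). b \<in> gs \<and> c \<in> gs \<and> gsrc b = grng th c \<and> gmul mul Xs b c = g \<and> Psi \<xi> b * Psi \<eta> c \<noteq> 0}"
  let ?f = "\<lambda>(b, c). Psi \<xi> b * Psi \<eta> c"
  let ?t = "\<lambda>(s, t) (b, c). gterm s (\<xi> s) b * gterm t (\<eta> t) c"
  have finI: "finite ?I"
    using \<xi> \<eta> L_finite by (intro finite_cartesian_product)
  then have finP: "finite ?P" by blast
  \<comment> \<open>A nonzero value of \<open>Psi\<close> needs a nonzero summand, so every
    contributing factorization comes from a pair of indices in the supports.\<close>
  have CP: "?C \<subseteq> ?P"
  proof clarify
    fix b c assume bc: "b \<in> gs" "c \<in> gs" "gsrc b = grng th c" "g = gmul mul Xs b c" "Psi \<xi> b * Psi \<eta> c \<noteq> 0"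
    have fac: "(b, c) \<in> factorizations g"
      using bc by blast
    have "Psi \<xi> b \<noteq> 0" "Psi \<eta> c \<noteq> 0"
      using bc(5) by auto
    then obtain s t where s: "s \<in> supp \<xi>" "gterm s (\<xi> s) b \<noteq> 0" and t: "t \<in> supp \<eta>" "gterm t (\<eta> t) c \<noteq> 0"
      unfolding Psi_def by (meson sum.not_neutral_contains_not_neutral)
    have "(b, c) = ?p (s, t)"
      using factorization_gterm[OF fac s(2) t(2)] by simp
    then have "(b, c) \<in> ?p ` ?I"
      by (rule image_eqI) (use s t in blast)
    then show "(b, c) \<in> factorizations (gmul mul Xs b c) \<inter> (\<lambda>(s, t). (gm s (th t (gsrc (gmul mul Xs b c))), gm t (gsrc (gmul mul Xs b c)))) ` ?I"
      using fac bc(4) by simp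
  qed
  have "conv mul Xs th (Psi \<xi>) (Psi \<eta>) g = sum ?f ?C"
    by (simp add: conv_def)
  also have "\<dots> = sum ?f ?P"
    by (rule sum.mono_neutral_left[OF finP CP]) auto
  also have "\<dots> = (\<Sum>q\<in>?P. \<Sum>i\<in>?I. ?t i q)"
  proof (rule sum.cong[OF refl])
    fix q :: "('s \<times> 'x) set \<times> ('s \<times> 'x) set"
    obtain b c where q: "q = (b, c)" by (cases q)
    show "?f q = (\<Sum>i\<in>?I. ?t i q)"
      unfolding q Psi_def by (simp add: sum_product sum.cartesian_product case_prod_unfold)
  qed
  also have "\<dots> = (\<Sum>i\<in>?I. \<Sum>q\<in>?P. ?t i q)"
    by (rule sum.swap)
  also have "\<dots> = (\<Sum>(s, t)\<in>?I. gterm (s \<cdot> t) (mterm s (\<xi> s) (\<eta> t)) g)"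
  proof (rule sum.cong[OF refl])
    fix i assume i: "i \<in> ?I"
    obtain s t where st: "i = (s, t)" by (cases i)
    define P where "P = ?P"
    define v where "v = gterm (s \<cdot> t) (mterm s (\<xi> s) (\<eta> t)) g"
    define q0 where "q0 = ?p (s, t)"
    define f where "f = ?t (s, t)"
    have nz: "q = q0" "f q = v" if q: "q \<in> P" "f q \<noteq> 0" for q
    proof -
      obtain b c where bc: "q = (b, c)" by (cases q)
      have "(b, c) \<in> factorizations g" "gterm s (\<xi> s) b \<noteq> 0" "gterm t (\<eta> t) c \<noteq> 0"
        using q unfolding bc P_def f_def by auto
      from factorization_gterm[OF this] show "q = q0" "f q = v"
        unfolding bc q0_def f_def v_def by simp_all
    qed
    have "(\<Sum>q\<in>P. f q) = v"
    proof (cases "v = 0")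
      case True
      \<comment> \<open>A nonzero summand would equal \<open>v\<close>, which is zero here.\<close>
      then show ?thesis
        using nz(2) by (metis sum.neutral)
    next
      case False
      then have ex: "q0 \<in> factorizations g" "f q0 = v"
        using factorization_exists[OF L_D[OF \<xi>] L_D[OF \<eta>]] by (simp_all add: q0_def f_def v_def)
      have "q0 \<in> ?p ` ?I"
        unfolding q0_def using i st by (intro imageI) simp
      with ex have "{q0} \<subseteq> P"
        unfolding P_def by blast
      moreover have "\<forall>q\<in>P - {q0}. f q = 0"
        using nz(1) by blast
      moreover have "finite P"
        using finP by (simp only: P_def)
      ultimately have "(\<Sum>q\<in>P. f q) = (\<Sum>q\<in>{q0}. f q)"
        by (intro sum.mono_neutral_right)
      then show ?thesis
        using ex(2) by simp
    qed
    then show "(\<Sum>q\<in>?P. ?t i q) = (case i of (s, t) \<Rightarrow> gterm (s \<cdot> t) (mterm s (\<xi> s) (\<eta> t)) g)"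
      unfolding st P_def f_def v_def by simp
  qed
  finally show ?thesis .
qed

section \<open>The isomorphism\<close>

text \<open>The isomorphism is taken from the Steinberg algebra to the quotient: the fibre of
  \<open>Psi\<close> over \<open>f\<close> is itself a coset of \<open>N\<close>, so no map out of
  the quotient has to be shown well defined.\<close>

definition Phi :: "(('s \<times> 'x) set \<Rightarrow> 'r::comm_ring_1) \<Rightarrow> ('s \<Rightarrow> 'x \<Rightarrow> 'r) set" where
  "Phi f = {\<xi> \<in> L. Psi \<xi> = f}"

text \<open>Cosets are fibres because \<open>Psi\<close> vanishes on \<open>N\<close> and, by
  \<open>kernel\<close>, only there.\<close>

lemma cp_class_eq_Phi:
  assumes \<xi>: "\<xi> \<in> L"
  shows "cp_class mul D \<xi> = Phi (Psi \<xi>)"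
proof -
  have "(\<lambda>t x. \<eta> t x - \<xi> t x) \<in> N \<longleftrightarrow> Psi \<eta> = Psi \<xi>" if \<eta>: "\<eta> \<in> L" for \<eta>
  proof
    assume "(\<lambda>t x. \<eta> t x - \<xi> t x) \<in> N"
    from Psi_N[OF this] show "Psi \<eta> = Psi \<xi>"
      using Psi_diff[OF \<eta> \<xi>] by (simp add: fun_eq_iff)
  next
    assume "Psi \<eta> = Psi \<xi>"
    then show "(\<lambda>t x. \<eta> t x - \<xi> t x) \<in> N"
      using L_combine[of "(-)", OF _ \<eta> \<xi>] Psi_diff[OF \<eta> \<xi>] by (intro kernel) simp_all
  qed
  then show ?thesis
    unfolding cp_class_def Phi_def by (intro Collect_cong conj_cong refl)
qed

text \<open>Surjectivity of \<open>Psi\<close> makes the fibre nonempty, so the representative that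
  the operations of the crossed product choose evaluates to \<open>f\<close>.\<close>

lemma Phi_some:
  assumes "f \<in> A"
  shows "(SOME \<xi>. \<xi> \<in> Phi f) \<in> L" "Psi (SOME \<xi>. \<xi> \<in> Phi f) = f"
proof -
  obtain \<xi> where "\<xi> \<in> Phi f"
    using Psi_surj[OF assms] unfolding Phi_def by blast
  then have some: "(SOME \<xi>. \<xi> \<in> Phi f) \<in> Phi f"
    by (rule someI[of "\<lambda>\<xi>. \<xi> \<in> Phi f"])
  have "\<xi> \<in> L \<and> Psi \<xi> = f" if "\<xi> \<in> Phi f" for \<xi>
    using that by (simp add: Phi_def)
  note * = this[OF some]
  show "(SOME \<xi>. \<xi> \<in> Phi f) \<in> L" "Psi (SOME \<xi>. \<xi> \<in> Phi f) = f"
    by (rule *[THEN conjunct1], rule *[THEN conjunct2])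
qed

lemma Phi_bij:
  "bij_betw Phi (A :: (('s \<times> 'x) set \<Rightarrow> 'r::comm_ring_1) set) (crossed_product mul D)"
  unfolding bij_betw_def
proof
  show "inj_on Phi (A :: (('s \<times> 'x) set \<Rightarrow> 'r) set)"
  proof (rule inj_onI)
    fix f h :: "('s \<times> 'x) set \<Rightarrow> 'r" assume fh: "f \<in> A" "h \<in> A" "Phi f = Phi h"
    have "f = Psi (SOME \<xi>. \<xi> \<in> Phi f)"
      by (rule Phi_some(2)[OF fh(1), symmetric])
    also have "\<dots> = h"
      unfolding fh(3) by (rule Phi_some(2)[OF fh(2)])
    finally show "f = h" .
  qed
  show "Phi ` (A :: (('s \<times> 'x) set \<Rightarrow> 'r) set) = crossed_product mul D"
  proof (intro equalityI subsetI)
    fix P assume "P \<in> Phi ` (A :: (('s \<times> 'x) set \<Rightarrow> 'r) set)"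
    then obtain f where f: "f \<in> A" "P = Phi f" by blast
    then obtain \<xi> where \<xi>: "\<xi> \<in> L" "Psi \<xi> = f"
      using Psi_surj by blast
    then have "P = cp_class mul D \<xi>"
      using cp_class_eq_Phi[OF \<xi>(1)] f by simp
    then show "P \<in> crossed_product mul D"
      unfolding crossed_product_def using \<xi>(1) by blast
  next
    fix P :: "('s \<Rightarrow> 'x \<Rightarrow> 'r) set" assume "P \<in> crossed_product mul D"
    then obtain \<xi> where \<xi>: "\<xi> \<in> L" "P = cp_class mul D \<xi>"
      unfolding crossed_product_def by blast
    show "P \<in> Phi ` A"
      unfolding \<xi>(2) cp_class_eq_Phi[OF \<xi>(1)] by (rule imageI[OF Psi_A[OF \<xi>(1)]])
  qed
qed

text \<open>Independence of representatives comes for free: the class of a formal sum depends only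
  on its value under \<open>Psi\<close>, and the chosen representatives have values \<open>f\<close>
  and \<open>h\<close>.\<close>

lemma Phi_add:
  assumes "f \<in> A" "h \<in> A"
  shows "Phi (\<lambda>a. f a + h a) = cp_add mul D (Phi f) (Phi h)"
proof -
  define \<xi> \<eta> where "\<xi> = (SOME \<xi>. \<xi> \<in> Phi f)" and "\<eta> = (SOME \<eta>. \<eta> \<in> Phi h)"
  have \<xi>: "\<xi> \<in> L" "Psi \<xi> = f" and \<eta>: "\<eta> \<in> L" "Psi \<eta> = h"
    using Phi_some[OF assms(1)] Phi_some[OF assms(2)] by (simp_all add: \<xi>_def \<eta>_def)
  have "cpL_add \<xi> \<eta> \<in> L"
    unfolding cpL_add_def using L_combine[of "(+)", OF _ \<xi>(1) \<eta>(1)] by simp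
  moreover have "Psi (cpL_add \<xi> \<eta>) = (\<lambda>a. f a + h a)"
    using Psi_add[OF \<xi>(1) \<eta>(1)] by (simp add: cpL_add_def fun_eq_iff \<xi>(2) \<eta>(2))
  ultimately show ?thesis
    unfolding cp_add_def \<xi>_def[symmetric] \<eta>_def[symmetric] by (simp only: cp_class_eq_Phi)
qed

lemma Phi_smul:
  assumes "f \<in> A"
  shows "Phi (\<lambda>a. c * f a) = cp_smul mul D c (Phi f)"
proof -
  define \<xi> where "\<xi> = (SOME \<xi>. \<xi> \<in> Phi f)"
  have \<xi>: "\<xi> \<in> L" "Psi \<xi> = f"
    using Phi_some[OF assms] by (simp_all add: \<xi>_def)
  have "cpL_smul c \<xi> \<in> L"
    \<comment> \<open>Scaling is the combination that ignores its first argument.\<close>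
    unfolding cpL_smul_def using L_combine[of "\<lambda>_ y. c * y", OF _ \<xi>(1) \<xi>(1)] by simp
  moreover have "Psi (cpL_smul c \<xi>) = (\<lambda>a. c * f a)"
    using Psi_linear[OF L_zero \<xi>(1), of c] by (simp add: cpL_smul_def fun_eq_iff \<xi>(2) Psi_def[of "\<lambda>_ _. 0"])
  ultimately show ?thesis
    unfolding cp_smul_def \<xi>_def[symmetric] by (simp only: cp_class_eq_Phi)
qed

text \<open>The product of the representatives and the convolution of their values both evaluate to
  the same sum over pairs of indices.\<close>

lemma Phi_mul:
  assumes "f \<in> A" "h \<in> A"
  shows "Phi (conv mul Xs th f h) = cp_mul mul D (dual_alpha mul Xs th) (Phi f) (Phi h)"
proof -
  define \<xi> \<eta> where "\<xi> = (SOME \<xi>. \<xi> \<in> Phi f)" and "\<eta> = (SOME \<eta>. \<eta> \<in> Phi h)"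
  have \<xi>: "\<xi> \<in> L" "Psi \<xi> = f" and \<eta>: "\<eta> \<in> L" "Psi \<eta> = h"
    using Phi_some[OF assms(1)] Phi_some[OF assms(2)] by (simp_all add: \<xi>_def \<eta>_def)
  have "Psi (cpL_mul mul (dual_alpha mul Xs th) \<xi> \<eta>) = conv mul Xs th f h"
    using Psi_mul[OF \<xi>(1) \<eta>(1)] conv_Psi[OF \<xi>(1) \<eta>(1)] by (simp add: fun_eq_iff \<xi>(2) \<eta>(2))
  then show ?thesis
    unfolding cp_mul_def \<xi>_def[symmetric] \<eta>_def[symmetric]
    using cp_class_eq_Phi[OF cpL_mul_L[OF \<xi>(1) \<eta>(1)]] by simp
qed

end

theorem theorem5p10:
  fixes mul :: "'s \<Rightarrow> 's \<Rightarrow> 's"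
    and X :: "'x topology"
    and Xs :: "'s \<Rightarrow> 'x set"
    and th :: "'s \<Rightarrow> 'x \<Rightarrow> 'x"
  assumes "inverse_semigroup mul"
    and "locally_compact_space X" and "Hausdorff_space X" and "X dim_le 0"
    and "top_partial_action mul X Xs th"
  shows "\<exists>\<Phi>. bij_betw \<Phi> (steinberg mul X Xs th :: (('s \<times> 'x) set \<Rightarrow> 'r::comm_ring_1) set)
                  (crossed_product mul (dualD X Xs))
         \<and> (\<forall>f\<in>steinberg mul X Xs th. \<forall>g\<in>steinberg mul X Xs th.
               \<Phi> (\<lambda>a. f a + g a) = cp_add mul (dualD X Xs) (\<Phi> f) (\<Phi> g) \<and>
               \<Phi> (conv mul Xs th f g) = cp_mul mul (dualD X Xs) (dual_alpha mul Xs th) (\<Phi> f) (\<Phi> g))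
         \<and> (\<forall>c. \<forall>f\<in>steinberg mul X Xs th.
               \<Phi> (\<lambda>a. c * f a) = cp_smul mul (dualD X Xs) c (\<Phi> f))"
proof -
  interpret partial_action mul X Xs th
    using assms by unfold_locales
  show ?thesis
    using Phi_bij Phi_add Phi_mul Phi_smul by (intro exI[of _ Phi] conjI ballI allI)
qed

end
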